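(* Let $f\colon\{-1,1\}^{n^2}\to\{-1,1\}$ be given by $f(x)=\mathrm{sign}\left(1+\sum_{i=1}^n\sum_{j=1}^n 2^ix_{ij}\right)$ and let $g\colon\{-1,1\}^{\lceil\sqrt n\rceil}\to\{-1,1\}$ be the majority function. Then $\deg_{\pm}(f\wedge g)=\Theta(\sqrt n)$.
   Context: Boolean values: $-1$ is true, $+1$ is false. Majority on $m$ bits: $\mathrm{MAJ}_m(x)=1$ if $\sum x_i>0$, $-1$ otherwise. $f\wedge g$ is $(x,y)\mapsto f(x)\wedge g(y)$ on the product of the domains. The threshold degree $\deg_{\pm}(h)$ is the least total degree of a real polynomial $p$ with $h(z)p(z)>0$ on the domain of $h$. *)

theory Defs
  imports Complex_Main "HOL-Library.Poly_Mapping" "HOL-Library.FuncSet" "HOL-Library.Landau_Symbols"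
begin

text \<open>
  A monomial over variables of type \<open>'v\<close> is its finitely supported exponent function; a real
  polynomial is a finitely supported coefficient function on monomials.
\<close>

type_synonym 'v monomial = "'v \<Rightarrow>\<^sub>0 nat"
type_synonym 'v rpoly = "'v monomial \<Rightarrow>\<^sub>0 real"

definition monomial_degree :: "'v monomial \<Rightarrow> nat" where
  "monomial_degree m = (\<Sum>v\<in>Poly_Mapping.keys m. Poly_Mapping.lookup m v)"

definition total_degree :: "'v rpoly \<Rightarrow> nat" where
  "total_degree p = Max (insert 0 (monomial_degree ` Poly_Mapping.keys p))"

definition poly_vars :: "'v rpoly \<Rightarrow> 'v set" where
  "poly_vars p = (\<Union>m\<in>Poly_Mapping.keys p. Poly_Mapping.keys m)"

definition monomial_eval :: "'v monomial \<Rightarrow> ('v \<Rightarrow> real) \<Rightarrow> real" where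
  "monomial_eval m z = (\<Prod>v\<in>Poly_Mapping.keys m. z v ^ Poly_Mapping.lookup m v)"

definition poly_eval :: "'v rpoly \<Rightarrow> ('v \<Rightarrow> real) \<Rightarrow> real" where
  "poly_eval p z = (\<Sum>m\<in>Poly_Mapping.keys p. Poly_Mapping.lookup p m * monomial_eval m z)"

definition sign_cube :: "'v set \<Rightarrow> ('v \<Rightarrow> real) set" where
  "sign_cube V = V \<rightarrow>\<^sub>E {-1, 1}"

definition sign_represents :: "'v set \<Rightarrow> 'v rpoly \<Rightarrow> (('v \<Rightarrow> real) \<Rightarrow> real) \<Rightarrow> bool" where
  "sign_represents V p h \<longleftrightarrow>
     poly_vars p \<subseteq> V \<and> (\<forall>z\<in>sign_cube V. h z * poly_eval p z > 0)"

text \<open>For a function \<open>h\<close> with domain \<open>sign_cube V\<close>, where \<open>V\<close> is finite.\<close>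

definition threshold_degree :: "'v set \<Rightarrow> (('v \<Rightarrow> real) \<Rightarrow> real) \<Rightarrow> nat" where
  "threshold_degree V h = (LEAST d. \<exists>p. sign_represents V p h \<and> total_degree p = d)"

text \<open>\<open>-1\<close> is true and \<open>1\<close> is false.\<close>

definition sign_and :: "real \<Rightarrow> real \<Rightarrow> real" where
  "sign_and a b = (if a = -1 \<and> b = -1 then -1 else 1)"

text \<open>
  The product of \<open>sign_cube V\<close> and \<open>sign_cube W\<close> is identified with \<open>sign_cube (V <+> W)\<close>:
  a point \<open>z\<close> of the latter is the pair \<open>(z \<circ> Inl, z \<circ> Inr)\<close>.
\<close>

definition fun_and ::
  "(('v \<Rightarrow> real) \<Rightarrow> real) \<Rightarrow> (('w \<Rightarrow> real) \<Rightarrow> real) \<Rightarrow> ('v + 'w \<Rightarrow> real) \<Rightarrow> real" where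
  "fun_and f g z = sign_and (f (z \<circ> Inl)) (g (z \<circ> Inr))"

definition majority :: "nat \<Rightarrow> (nat \<Rightarrow> real) \<Rightarrow> real" where
  "majority m x = (if (\<Sum>i=1..m. x i) > 0 then 1 else -1)"

text \<open>
  On the cube the argument of \<open>sgn\<close> is an odd integer, so the value \<open>0\<close> does not occur.
\<close>

definition weighted_halfspace :: "nat \<Rightarrow> (nat \<times> nat \<Rightarrow> real) \<Rightarrow> real" where
  "weighted_halfspace n x = sgn (1 + (\<Sum>i=1..n. \<Sum>j=1..n. 2 ^ i * x (i, j)))"

end

theory Submission
  imports Defs "HOL-Computational_Algebra.Polynomial"
begin

text \<open>
  For the upper bound, add to the halfspace form a large multiple of the product of the factors
  \<open>s - (2 * l - m)\<close>, \<open>l \<le> m div 2\<close>, where \<open>s\<close> is the sum of the \<open>m\<close> majority inputs: the product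
  vanishes exactly where the majority is true and is at least 1 elsewhere.

  For the lower bound, suppose a polynomial of degree \<open>d\<close> sign-represents the conjunction.
  Averaging over the points whose majority part has \<open>l\<close> positive entries makes it a polynomial in \<open>l\<close>.
  The halfspace part is averaged over a random point whose weighted sum is within \<open>2 * (d + 1)\<close> of a
  prescribed \<open>t\<close>: the blocks are drawn from the most significant one downwards, each with
  cardinal B-spline weights of degree \<open>d\<close>. As the moments of order at most \<open>d\<close> of such weights do
  not depend on the position of the spline relative to the lattice, the average is a polynomial in \<open>t\<close>
  of degree at most \<open>d\<close>. For the resulting \<open>P t l\<close>, let \<open>Ql\<close> and \<open>Qh\<close> be its sums over \<open>l \<le> m div 2\<close> and
  over \<open>l > m div 2\<close>. Extrapolation in \<open>l\<close> bounds each by \<open>2 ^ O(m)\<close> times the other when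
  \<open>2 * d < m\<close>. But \<open>Ql\<close> has the sign of \<open>t\<close> and \<open>Qh\<close> is positive at \<open>t = \<plusminus> 2 ^ k\<close>, so on a range of
  \<open>n / O(d)\<close> consecutive \<open>k\<close> on which both are governed by a single monomial their quotient behaves
  like an odd power of \<open>t\<close> and varies by a factor \<open>2 ^ (n / O(d))\<close>. Hence \<open>n \<le> O(d * m)\<close>.
\<close>

section \<open>B-splines\<close>

text \<open>The cardinal B-spline of degree \<open>k\<close> with knots 0, ...,
  \<open>k + 1\<close>, given by the Cox-de Boor recursion. The half-open base interval makes the
  integer translates of degree 0 partition the line.\<close>

fun bspline :: "nat \<Rightarrow> real \<Rightarrow> real" where
  "bspline 0 x = (if 0 \<le> x \<and> x < 1 then 1 else 0)"
| "bspline (Suc k) x = (x * bspline k x + (real k + 2 - x) * bspline k (x - 1)) / (real k + 1)"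

lemma bspline_eq_0: "x < 0 \<or> x \<ge> real k + 1 \<Longrightarrow> bspline k x = 0"
  by (induction k arbitrary: x) auto

lemma bspline_nonneg: "bspline k x \<ge> 0"
proof (induction k arbitrary: x)
  case (Suc k)
  have "x * bspline k x \<ge> 0"
    using Suc[of x] bspline_eq_0[of x k] by (cases "x < 0") auto
  moreover have "(real k + 2 - x) * bspline k (x - 1) \<ge> 0"
    using Suc[of "x - 1"] bspline_eq_0[of "x - 1" k] by (cases "x \<ge> real k + 2") auto
  ultimately show ?case by simp
qed auto

text \<open>Summation by parts: the term with \<open>bspline k (x - 1)\<close> is re-indexed by one
  lattice point. The bounds on \<open>a\<close> and \<open>a + real N\<close> place both boundary
  terms outside the support of the spline.\<close>

lemma bspline_sum_step:
  assumes "a \<le> 0" "a + real N \<ge> real k + 2"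
  shows "(\<Sum>l\<le>N. bspline (Suc k) (a + real l) * g (a + real l)) =
    (\<Sum>l\<le>N. bspline k (a + real l) *
       ((a + real l) * g (a + real l) + (real k + 1 - (a + real l)) * g (a + real l + 1))) / (real k + 1)"
proof -
  obtain M where N: "N = Suc M" using assms by (cases N) auto
  define h where "h = (\<lambda>x. (real k + 1 - x) * bspline k x * g (x + 1))"
  have "(\<Sum>l\<le>N. h (a + real l - 1)) = h (a - 1) + (\<Sum>l\<le>M. h (a + real l))"
    unfolding N sum.atMost_Suc_shift by (simp add: algebra_simps)
  also have "h (a - 1) = 0" using bspline_eq_0[of "a - 1" k] assms by (simp add: h_def)
  also have "0 + (\<Sum>l\<le>M. h (a + real l)) = (\<Sum>l\<le>N. h (a + real l))"
    using bspline_eq_0[of "a + real N" k] assms by (simp add: h_def N)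
  finally have shift: "(\<Sum>l\<le>N. h (a + real l - 1)) = (\<Sum>l\<le>N. h (a + real l))" .
  have "(\<Sum>l\<le>N. bspline (Suc k) (a + real l) * g (a + real l)) =
     (\<Sum>l\<le>N. (a + real l) * bspline k (a + real l) * g (a + real l) + h (a + real l - 1)) / (real k + 1)"
    unfolding sum_divide_distrib by (rule sum.cong) (auto simp: h_def field_simps)
  also have "\<dots> = (\<Sum>l\<le>N. (a + real l) * bspline k (a + real l) * g (a + real l) + h (a + real l)) / (real k + 1)"
    by (simp only: sum.distrib shift)
  also have "\<dots> = (\<Sum>l\<le>N. bspline k (a + real l) *
       ((a + real l) * g (a + real l) + (real k + 1 - (a + real l)) * g (a + real l + 1))) / (real k + 1)"
    by (rule arg_cong2[where f = "(/)"], rule sum.cong) (auto simp: h_def algebra_simps)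
  finally show ?thesis .
qed

text \<open>For constant \<open>g\<close> the bracket in \<open>bspline_sum_step\<close> is the
  constant \<open>real k + 1\<close>, so each degree inherits the sum from the one below. In degree
  0 exactly one lattice point meets the support.\<close>

lemma bspline_sum_eq_1:
  assumes "a \<le> 0" "a + real N \<ge> real k + 1"
  shows "(\<Sum>l\<le>N. bspline k (a + real l)) = 1"
  using assms
proof (induction k)
  case 0
  define c where "c = nat \<lceil>-a\<rceil>"
  have c: "real c - 1 < -a" "-a \<le> real c" using 0 by (auto simp: c_def) linarith?
  have "c \<le> N" using c 0 by linarith
  have "bspline 0 (a + real l) = (if l = c then 1 else 0)" for l
    using c by (auto simp: not_less)
  then have "(\<Sum>l\<le>N. bspline 0 (a + real l)) = (\<Sum>l\<le>N. if l = c then 1 else 0)"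
    by (rule sum.cong[OF refl])
  then show ?case using \<open>c \<le> N\<close> by (simp del: bspline.simps)
next
  case (Suc k)
  have "a + real N \<ge> real k + 2" using Suc.prems by simp
  from bspline_sum_step[OF Suc.prems(1) this, of "\<lambda>_. 1"] show ?case
    using Suc by (simp add: sum_distrib_right[symmetric] del: bspline.simps)
qed

text \<open>Offset 0 is the reference point for lattice sums that turn out not to depend on the
  offset.\<close>

definition bspline_mean :: "nat \<Rightarrow> (real \<Rightarrow> real) \<Rightarrow> real" where
  "bspline_mean k g = (\<Sum>l\<le>Suc k. bspline k (real l) * g (real l))"

text \<open>One step of the recursion trades \<open>x ^ i\<close> for a combination of powers of
  order at most \<open>k\<close>, whose lattice sums are independent of the offset by
  induction.\<close>

lemma bspline_moment:
  assumes "i \<le> k" "a \<le> 0" "a + real N \<ge> real k + 1"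
  shows "(\<Sum>l\<le>N. bspline k (a + real l) * (a + real l) ^ i) = bspline_mean k (\<lambda>x. x ^ i)"
  using assms
proof (induction k arbitrary: i a N)
  case 0
  then show ?case using bspline_sum_eq_1[of a 0 N] bspline_sum_eq_1[of 0 0 1]
    by (simp add: bspline_mean_def del: bspline.simps)
next
  case (Suc k)
  \<comment> \<open>Coefficients of
    \<open>(real k + 2) * (x + 1) ^ i - ((x + 1) ^ Suc i - x ^ Suc i)\<close>, a rearrangement of
    the left side of \<open>expand\<close>.\<close>
  define e where "e = (\<lambda>r. (real k + 2) * real (i choose r) - real (Suc i choose r))"
  have expand: "x * x ^ i + (real k + 1 - x) * (x + 1) ^ i = (\<Sum>r\<le>i. e r * x ^ r)" for x
  proof -
    have "(\<Sum>r\<le>i. e r * x ^ r) = (real k + 2) * (\<Sum>r\<le>i. real (i choose r) * x ^ r)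
            - (\<Sum>r\<le>i. real (Suc i choose r) * x ^ r)"
      by (simp add: e_def sum_distrib_left sum_subtractf algebra_simps)
    also have "(\<Sum>r\<le>i. real (i choose r) * x ^ r) = (x + 1) ^ i"
      by (simp add: binomial_ring)
    also have "(\<Sum>r\<le>i. real (Suc i choose r) * x ^ r) = (x + 1) ^ Suc i - x ^ Suc i"
      unfolding binomial_ring by simp
    finally show ?thesis by (simp add: algebra_simps)
  qed
  \<comment> \<open>The top coefficient vanishes exactly when \<open>i = k + 1\<close>, which is why each order gains one moment.\<close>
  have top: "e r = 0" if "r \<le> i" "r > k" for r
    using that Suc.prems by (auto simp: e_def le_Suc_eq)
  have main: "(\<Sum>l\<le>N. bspline (Suc k) (a + real l) * (a + real l) ^ i) =
      (\<Sum>r\<le>i. e r * bspline_mean k (\<lambda>x. x ^ r)) / (real k + 1)"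
    if a: "a \<le> 0" "a + real N \<ge> real (Suc k) + 1" for a N
  proof -
    have "(\<Sum>l\<le>N. bspline (Suc k) (a + real l) * (a + real l) ^ i) =
        (\<Sum>l\<le>N. bspline k (a + real l) * (\<Sum>r\<le>i. e r * (a + real l) ^ r)) / (real k + 1)"
      using bspline_sum_step[of a k N "\<lambda>x. x ^ i"] a unfolding expand
      by (simp del: bspline.simps)
    also have "(\<Sum>l\<le>N. bspline k (a + real l) * (\<Sum>r\<le>i. e r * (a + real l) ^ r)) =
        (\<Sum>r\<le>i. e r * (\<Sum>l\<le>N. bspline k (a + real l) * (a + real l) ^ r))"
      unfolding sum_distrib_left by (subst sum.swap) (simp add: mult_ac)
    also have "\<dots> = (\<Sum>r\<le>i. e r * bspline_mean k (\<lambda>x. x ^ r))"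
    proof (intro sum.cong refl)
      fix r assume "r \<in> {..i}"
      then show "e r * (\<Sum>l\<le>N. bspline k (a + real l) * (a + real l) ^ r) = e r * bspline_mean k (\<lambda>x. x ^ r)"
        using top[of r] Suc.IH[of r a N] a by (cases "r \<le> k") auto
    qed
    finally show ?thesis .
  qed
  show ?case
    using main[OF Suc.prems(2,3)] main[of 0 "Suc (Suc k)"]
    by (simp add: bspline_mean_def del: bspline.simps sum.atMost_Suc)
qed

section \<open>Real functions that are polynomials of bounded degree\<close>

definition poly_le :: "nat \<Rightarrow> (real \<Rightarrow> real) \<Rightarrow> bool" where
  "poly_le d f \<longleftrightarrow> (\<exists>p. degree p \<le> d \<and> f = poly p)"

lemma poly_le_const: "poly_le d (\<lambda>_. c)"
  unfolding poly_le_def by (rule exI[of _ "[:c:]"]) auto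

lemma poly_le_mono: "poly_le d f \<Longrightarrow> d \<le> e \<Longrightarrow> poly_le e f"
  unfolding poly_le_def by (metis order_trans)

lemma poly_le_linear: "poly_le (Suc 0) (\<lambda>x. a + b * x)"
  unfolding poly_le_def by (rule exI[of _ "[:a, b:]"]) (auto simp: mult.commute)

lemma poly_le_add: "poly_le d f \<Longrightarrow> poly_le d g \<Longrightarrow> poly_le d (\<lambda>x. f x + g x)"
  unfolding poly_le_def
proof (elim exE conjE)
  fix p q assume "degree p \<le> d" "f = poly p" "degree q \<le> d" "g = poly q"
  then show "\<exists>r. degree r \<le> d \<and> (\<lambda>x. f x + g x) = poly r"
    by (intro exI[of _ "p + q"]) (auto simp: degree_add_le)
qed

lemma poly_le_mult: "poly_le d f \<Longrightarrow> poly_le e g \<Longrightarrow> poly_le (d + e) (\<lambda>x. f x * g x)"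
  unfolding poly_le_def
proof (elim exE conjE)
  fix p q assume "degree p \<le> d" "f = poly p" "degree q \<le> e" "g = poly q"
  then show "\<exists>r. degree r \<le> d + e \<and> (\<lambda>x. f x * g x) = poly r"
    using degree_mult_le[of p q] by (intro exI[of _ "p * q"]) auto
qed

lemma poly_le_cmult: "poly_le d f \<Longrightarrow> poly_le d (\<lambda>x. c * f x)"
  using poly_le_mult[OF poly_le_const[of 0 c]] by simp

lemma poly_le_sum: "(\<And>i. i \<in> I \<Longrightarrow> poly_le d (f i)) \<Longrightarrow> poly_le d (\<lambda>x. \<Sum>i\<in>I. f i x)"
  by (induction I rule: infinite_finite_induct) (auto intro: poly_le_const poly_le_add)

lemma poly_le_power: "poly_le d f \<Longrightarrow> poly_le (k * d) (\<lambda>x. f x ^ k)"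
  by (induction k) (auto intro: poly_le_const poly_le_mult)

lemma poly_le_compose_linear:
  assumes "poly_le d f" shows "poly_le d (\<lambda>x. f (a + b * x))"
proof -
  obtain p where p: "degree p \<le> d" "f = poly p" using assms by (auto simp: poly_le_def)
  have "(\<lambda>x. f (a + b * x)) = poly (pcompose p [:a, b:])"
    by (auto simp: p poly_pcompose mult.commute)
  moreover have "degree (pcompose p [:a, b:]) \<le> d"
    using degree_pcompose_le[of p "[:a, b:]"] p by (simp split: if_splits)
  ultimately show ?thesis by (auto simp: poly_le_def)
qed

lemma poly_le_altdef:
  assumes "poly_le d f" obtains c where "\<And>x. f x = (\<Sum>i\<le>d. c i * x ^ i)"
proof -
  obtain p where p: "degree p \<le> d" "f = poly p" using assms by (auto simp: poly_le_def)
  have "poly p x = (\<Sum>i\<le>d. coeff p i * x ^ i)" for x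
    unfolding poly_altdef using p by (intro sum.mono_neutral_left) (auto simp: coeff_eq_0)
  then show ?thesis using that[of "coeff p"] p by auto
qed

section \<open>Lattice sums of polynomials against splines\<close>

lemma bspline_poly_moment:
  assumes "poly_le k g" "a \<le> 0" "a + real N \<ge> real k + 1"
  shows "(\<Sum>l\<le>N. bspline k (a + real l) * g (a + real l)) = bspline_mean k g"
proof -
  obtain e where e: "\<And>x. g x = (\<Sum>i\<le>k. e i * x ^ i)" using poly_le_altdef[OF assms(1)] by blast
  have *: "(\<Sum>l\<le>N. bspline k (a + real l) * g (a + real l)) =
      (\<Sum>r\<le>k. e r * bspline_mean k (\<lambda>x. x ^ r))"
    if a: "a \<le> 0" "a + real N \<ge> real k + 1" for a N
  proof -
    have "(\<Sum>l\<le>N. bspline k (a + real l) * g (a + real l)) =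
        (\<Sum>r\<le>k. e r * (\<Sum>l\<le>N. bspline k (a + real l) * (a + real l) ^ r))"
      unfolding sum_distrib_left e by (subst sum.swap) (simp add: mult_ac)
    also have "\<dots> = (\<Sum>r\<le>k. e r * bspline_mean k (\<lambda>x. x ^ r))"
      using bspline_moment[OF _ a] by (intro sum.cong refl) auto
    finally show ?thesis .
  qed
  have "bspline_mean k g = (\<Sum>l\<le>Suc k. bspline k (0 + real l) * g (0 + real l))"
    unfolding bspline_mean_def by simp
  then show ?thesis
    using *[OF assms(2,3)] *[of 0 "Suc k"] by simp
qed

text \<open>Write \<open>real l\<close> as \<open>(a + real l) - a\<close> inside \<open>A\<close>
  and expand: each power of \<open>a + real l\<close> times \<open>g\<close> has degree at most
  \<open>k\<close>, so its lattice sum is a constant. Powers of \<open>a\<close> come only from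
  \<open>A\<close>, hence degree \<open>s\<close> and not \<open>s + e\<close>.\<close>

lemma bspline_mixed_moment:
  assumes "poly_le s A" "poly_le e g" "s + e \<le> k"
  shows "\<exists>F. poly_le s F \<and> (\<forall>a N. a \<le> 0 \<longrightarrow> a + real N \<ge> real k + 1 \<longrightarrow>
           (\<Sum>l\<le>N. bspline k (a + real l) * (A (real l) * g (a + real l))) = F a)"
proof -
  obtain q where q: "\<And>x. A x = (\<Sum>i\<le>s. q i * x ^ i)" using poly_le_altdef[OF assms(1)] by blast
  define c where "c = (\<lambda>i. bspline_mean k (\<lambda>x. x ^ i * g x))"
  have c: "(\<Sum>l\<le>N. bspline k (a + real l) * ((a + real l) ^ i * g (a + real l))) = c i"
    if "i \<le> s" "a \<le> 0" "a + real N \<ge> real k + 1" for i a N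
  proof -
    have "poly_le i (\<lambda>x::real. x ^ i)"
      using poly_le_power[OF poly_le_linear[of 0 1], of i] by simp
    from poly_le_mult[OF this assms(2)] have "poly_le k (\<lambda>x. x ^ i * g x)"
      by (rule poly_le_mono) (use that assms in auto)
    from bspline_poly_moment[OF this that(2,3)] show ?thesis by (simp add: c_def)
  qed
  define F where "F = (\<lambda>a. \<Sum>i\<le>s. q i * (\<Sum>r\<le>i. (real (i choose r) * c r) * (0 + (-1) * a) ^ (i - r)))"
  have "poly_le s F"
    unfolding F_def
  proof (intro poly_le_sum poly_le_cmult)
    fix i r assume "i \<in> {..s}" "r \<in> {..i}"
    then show "poly_le s (\<lambda>x. (0 + (-1) * x) ^ (i - r))"
      using poly_le_mono[OF poly_le_power[OF poly_le_linear[of 0 "-1"], of "i - r"]] by auto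
  qed
  moreover have "(\<Sum>l\<le>N. bspline k (a + real l) * (A (real l) * g (a + real l))) = F a"
    if a: "a \<le> 0" "a + real N \<ge> real k + 1" for a N
  proof -
    have pow: "real l ^ i = (\<Sum>r\<le>i. real (i choose r) * (a + real l) ^ r * (-a) ^ (i - r))" for l i
      using binomial_ring[of "a + real l" "-a" i] by simp
    have "(\<Sum>l\<le>N. bspline k (a + real l) * (A (real l) * g (a + real l))) =
       (\<Sum>l\<le>N. \<Sum>i\<le>s. \<Sum>r\<le>i. q i * (real (i choose r) * (-a) ^ (i - r) *
           (bspline k (a + real l) * ((a + real l) ^ r * g (a + real l)))))"
      unfolding q pow sum_distrib_left sum_distrib_right
      by (intro sum.cong refl) (simp only: mult_ac)
    also have "\<dots> = (\<Sum>i\<le>s. \<Sum>r\<le>i. \<Sum>l\<le>N. q i * (real (i choose r) * (-a) ^ (i - r) *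
           (bspline k (a + real l) * ((a + real l) ^ r * g (a + real l)))))"
      by (subst sum.swap, rule sum.cong, rule refl, subst sum.swap, rule refl)
    also have "\<dots> = (\<Sum>i\<le>s. \<Sum>r\<le>i. q i * (real (i choose r) * (-a) ^ (i - r) * c r))"
      unfolding sum_distrib_left[symmetric] using c a by (intro sum.cong refl) auto
    also have "\<dots> = F a" unfolding F_def by (simp add: sum_distrib_left mult_ac)
    finally show ?thesis .
  qed
  ultimately show ?thesis by blast
qed

section \<open>Symmetrization, extrapolation and sign patterns\<close>

lemma poly_le_prod_linear: "poly_le k (\<lambda>x. \<Prod>i<k. x - real i)"
proof (induction k)
  case (Suc k)
  have "poly_le 1 (\<lambda>x. x - real k)" using poly_le_linear[of "- real k" 1] by simp
  from poly_le_mult[OF Suc this] show ?case by (simp add: mult.commute)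
qed (simp add: poly_le_const)

lemma poly_le_gbinomial: "poly_le k (\<lambda>x. x gchoose k)"
proof -
  have "(\<lambda>x::real. x gchoose k) = (\<lambda>x. (1 / fact k) * (\<Prod>i<k. x - real i))"
    by (auto simp: gbinomial_prod_rev atLeast0LessThan)
  then show ?thesis using poly_le_cmult[OF poly_le_prod_linear] by metis
qed

text \<open>\<open>T\<close> encodes the sign vector that is 1 on \<open>T\<close> and -1 elsewhere;
  this is the multilinear monomial over \<open>S\<close> at that vector.\<close>

definition character :: "'a set \<Rightarrow> 'a set \<Rightarrow> real" where
  "character S T = (\<Prod>j\<in>S. if j \<in> T then 1 else - 1)"

text \<open>Removing \<open>U\<close> identifies the sets counted with subsets of
  \<open>A - U\<close>. The form without division also covers \<open>card U > l\<close>, where both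
  sides vanish.\<close>

lemma card_subsets_containing:
  assumes "finite A" "U \<subseteq> A" "l \<le> card A"
  shows "card {T. T \<subseteq> A \<and> card T = l \<and> U \<subseteq> T} * (card A choose card U)
       = (card A choose l) * (l choose card U)"
proof (cases "card U \<le> l")
  case True
  have fin: "finite U" using assms finite_subset by blast
  have "bij_betw (\<lambda>T. T \<union> U) {T. T \<subseteq> A - U \<and> card T = l - card U}
          {T. T \<subseteq> A \<and> card T = l \<and> U \<subseteq> T}"
  proof (rule bij_betwI[where g = "\<lambda>T. T - U"])
    show "(\<lambda>T. T \<union> U) \<in> {T. T \<subseteq> A - U \<and> card T = l - card U} \<rightarrow> {T. T \<subseteq> A \<and> card T = l \<and> U \<subseteq> T}"
    proof safe
      fix T assume T: "T \<subseteq> A - U" "card T = l - card U"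
      then have "card (T \<union> U) = card T + card U"
        using fin assms by (intro card_Un_disjoint) (auto intro: finite_subset)
      then show "card (T \<union> U) = l" using T True by simp
    qed (use assms in auto)
    show "(\<lambda>T. T - U) \<in> {T. T \<subseteq> A \<and> card T = l \<and> U \<subseteq> T} \<rightarrow> {T. T \<subseteq> A - U \<and> card T = l - card U}"
      using fin by (auto simp: card_Diff_subset)
  qed auto
  from bij_betw_same_card[OF this]
  have "card {T. T \<subseteq> A \<and> card T = l \<and> U \<subseteq> T} = (card A - card U) choose (l - card U)"
    using n_subsets[of "A - U" "l - card U"] assms fin by (simp add: card_Diff_subset)
  then show ?thesis using choose_mult[OF True assms(3)] by simp
next
  case False
  have "{T. T \<subseteq> A \<and> card T = l \<and> U \<subseteq> T} = {}"
    using False assms by (auto dest: card_mono[rotated] finite_subset)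
  then have "card {T. T \<subseteq> A \<and> card T = l \<and> U \<subseteq> T} = 0" by (simp only: card.empty)
  then show ?thesis using False by simp
qed

text \<open>The set \<open>U\<close> makes the induction work: a sign factor at \<open>j\<close> is
  twice the indicator of \<open>j \<in> T\<close> minus 1, so an index leaving \<open>S\<close>
  either moves into \<open>U\<close> or disappears. With \<open>S\<close> empty the count of
  supersets of \<open>U\<close> gives a binomial coefficient in \<open>l\<close>.\<close>

lemma symmetrization_aux:
  assumes "finite A" "S \<subseteq> A" "U \<subseteq> A" "U \<inter> S = {}"
  shows "\<exists>F. poly_le (card U + card S) F \<and> (\<forall>l\<le>card A.
     (\<Sum>T | T \<subseteq> A \<and> card T = l. of_bool (U \<subseteq> T) * character S T) = real (card A choose l) * F (real l))"
proof -
  have "finite S" using assms finite_subset by blast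
  then show ?thesis using assms(2-)
  proof (induction S arbitrary: U rule: finite_induct)
    case empty
    define F where "F = (\<lambda>x. 1 / real (card A choose card U) * (x gchoose card U))"
    have le: "card U \<le> card A" using assms(1) empty by (simp add: card_mono)
    have "(\<Sum>T | T \<subseteq> A \<and> card T = l. of_bool (U \<subseteq> T) * character {} T) = real (card A choose l) * F (real l)"
      if "l \<le> card A" for l
    proof -
      have "(\<Sum>T | T \<subseteq> A \<and> card T = l. of_bool (U \<subseteq> T) * character {} T)
          = real (card {T. T \<subseteq> A \<and> card T = l \<and> U \<subseteq> T})"
        using assms(1) by (simp add: character_def of_bool_def sum.If_cases Collect_conj_eq Int_assoc)
      also have "\<dots> = real (card A choose l) * real (l choose card U) / real (card A choose card U)"
        using arg_cong[OF card_subsets_containing[OF assms(1) empty(2) that], of real] le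
        by (simp add: field_simps)
      finally show ?thesis by (simp add: F_def binomial_gbinomial)
    qed
    moreover have "poly_le (card U) F" unfolding F_def by (intro poly_le_cmult poly_le_gbinomial)
    ultimately show ?case by auto
  next
    case (insert j S)
    have jU: "j \<notin> U" and sub: "S \<subseteq> A" "insert j U \<subseteq> A" "insert j U \<inter> S = {}" "U \<inter> S = {}"
      using insert.prems insert.hyps by auto
    have fU: "finite U" by (rule finite_subset[OF insert.prems(2) assms(1)])
    obtain F where F: "poly_le (card (insert j U) + card S) F" "\<And>l. l \<le> card A \<Longrightarrow>
      (\<Sum>T | T \<subseteq> A \<and> card T = l. of_bool (insert j U \<subseteq> T) * character S T) = real (card A choose l) * F (real l)"
      using insert.IH[OF sub(1-3)] by blast
    obtain G where G: "poly_le (card U + card S) G" "\<And>l. l \<le> card A \<Longrightarrow>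
      (\<Sum>T | T \<subseteq> A \<and> card T = l. of_bool (U \<subseteq> T) * character S T) = real (card A choose l) * G (real l)"
      using insert.IH[OF sub(1) insert.prems(2) sub(4)] by blast
    have F1: "poly_le (card U + card (insert j S)) F" using F(1) insert.hyps fU jU by simp
    have G1: "poly_le (card U + card (insert j S)) G"
      using insert.hyps by (intro poly_le_mono[OF G(1)]) auto
    have "of_bool (U \<subseteq> T) * character (insert j S) T =
       2 * (of_bool (insert j U \<subseteq> T) * character S T) + (- 1) * (of_bool (U \<subseteq> T) * character S T)" for T
      using insert.hyps by (auto simp: character_def)
    then have "(\<Sum>T | T \<subseteq> A \<and> card T = l. of_bool (U \<subseteq> T) * character (insert j S) T) =
        real (card A choose l) * (2 * F (real l) + (- 1) * G (real l))" if "l \<le> card A" for l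
      using F(2)[OF that] G(2)[OF that]
      by (simp only: sum.distrib sum_distrib_left[symmetric]) (simp add: algebra_simps)
    moreover have "poly_le (card U + card (insert j S)) (\<lambda>x. 2 * F x + (- 1) * G x)"
      by (intro poly_le_add poly_le_cmult F1 G1)
    ultimately show ?case
      by (intro exI[of _ "\<lambda>x. 2 * F x + (- 1) * G x"]) auto
  qed
qed

text \<open>Minsky-Papert symmetrization, with the average over a level multiplied by the size of
  the level.\<close>

lemma symmetrization:
  assumes "finite A" "S \<subseteq> A"
  obtains F where "poly_le (card S) F" "\<And>l. l \<le> card A \<Longrightarrow>
     (\<Sum>T | T \<subseteq> A \<and> card T = l. character S T) = real (card A choose l) * F (real l)"
  using symmetrization_aux[OF assms, of "{}"] by auto

section \<open>Extrapolation by finite differences\<close>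

lemma poly_le_difference:
  assumes "poly_le (Suc d) f"
  shows "poly_le d (\<lambda>x. f (x + 1) - f x)"
proof -
  obtain c where c: "\<And>x. f x = (\<Sum>i\<le>Suc d. c i * x ^ i)" using poly_le_altdef[OF assms] by blast
  have pow: "(x + 1) ^ i - x ^ i = (\<Sum>r<i. real (i choose r) * x ^ r)" for x :: real and i
    using binomial_ring[of x 1 i] by (simp add: lessThan_Suc_atMost[symmetric])
  have "(\<lambda>x. f (x + 1) - f x) = (\<lambda>x. \<Sum>i\<le>Suc d. c i * (\<Sum>r<i. real (i choose r) * x ^ r))"
    unfolding c sum_subtractf[symmetric] pow[symmetric] by (simp only: right_diff_distrib)
  moreover have "poly_le d (\<lambda>x. \<Sum>i\<le>Suc d. c i * (\<Sum>r<i. real (i choose r) * x ^ r))"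
  proof (intro poly_le_sum poly_le_cmult)
    fix i r assume "i \<in> {..Suc d}" "r \<in> {..<i}"
    then show "poly_le d (\<lambda>x. x ^ r)"
      using poly_le_mono[OF poly_le_power[OF poly_le_linear[of 0 1], of r], of d] by simp
  qed
  ultimately show ?thesis by metis
qed

text \<open>Induction on the degree: the forward difference has smaller degree and is bounded by
  \<open>2 * M\<close> at the first nodes; adding up its values recovers \<open>f\<close>.\<close>

lemma poly_extrapolation:
  assumes "poly_le d f" "\<And>i. i \<le> d \<Longrightarrow> \<bar>f (real i)\<bar> \<le> M"
  shows "\<bar>f (real l)\<bar> \<le> 2 ^ (l + d) * M"
  using assms
proof (induction d arbitrary: f M l)
  case 0
  then obtain c where c: "\<And>x. f x = c" using poly_le_altdef[OF 0(1)] by auto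
  have "1 * M \<le> 2 ^ l * M" using 0(2)[of 0] by (intro mult_right_mono) auto
  then show ?case using c 0(2)[of 0] by simp
next
  case (Suc d)
  define g where "g = (\<lambda>x. f (x + 1) - f x)"
  have M: "M \<ge> 0" using Suc.prems(2)[of 0] by simp
  have g: "\<bar>g (real j)\<bar> \<le> 2 ^ (j + d) * (2 * M)" for j
  proof (rule Suc.IH)
    show "poly_le d g" unfolding g_def by (rule poly_le_difference) fact
    fix i assume "i \<le> d"
    then show "\<bar>g (real i)\<bar> \<le> 2 * M"
      using Suc.prems(2)[of i] Suc.prems(2)[of "Suc i"] by (simp add: g_def add.commute)
  qed
  show ?case
  proof (induction l)
    case 0
    have "1 * M \<le> 2 ^ Suc d * M" using M by (intro mult_right_mono) (auto intro: one_le_power simp del: power_Suc)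
    then show ?case using Suc.prems(2)[of 0] by simp
  next
    case (Suc l)
    have "f (real (Suc l)) = f (real l) + g (real l)" by (simp add: g_def add.commute)
    then show ?case using Suc g[of l] by (simp add: power_add)
  qed
qed

text \<open>The largest index of a dominant term of \<open>\<Sum>i\<le>d. c i * t ^ i\<close> at \<open>\<bar>t\<bar> = 2 ^ k\<close>.\<close>

definition dominant :: "(nat \<Rightarrow> real) \<Rightarrow> nat \<Rightarrow> nat \<Rightarrow> nat" where
  "dominant c d k = Max {j. j \<le> d \<and> (\<forall>i\<le>d. \<bar>c i\<bar> * 2 ^ (i * k) \<le> \<bar>c j\<bar> * 2 ^ (j * k))}"

lemma dominant:
  shows "dominant c d k \<le> d"
    and "i \<le> d \<Longrightarrow> \<bar>c i\<bar> * 2 ^ (i * k) \<le> \<bar>c (dominant c d k)\<bar> * 2 ^ (dominant c d k * k)"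
    and "j \<le> d \<Longrightarrow> (\<And>i. i \<le> d \<Longrightarrow> \<bar>c i\<bar> * 2 ^ (i * k) \<le> \<bar>c j\<bar> * 2 ^ (j * k)) \<Longrightarrow> j \<le> dominant c d k"
proof -
  let ?X = "{j. j \<le> d \<and> (\<forall>i\<le>d. \<bar>c i\<bar> * 2 ^ (i * k) \<le> \<bar>c j\<bar> * 2 ^ (j * k))}"
  have fin: "finite ?X" by (rule finite_subset[of _ "{..d}"]) auto
  define v where "v = Max ((\<lambda>i. \<bar>c i\<bar> * 2 ^ (i * k)) ` {..d})"
  have "v \<in> (\<lambda>i. \<bar>c i\<bar> * 2 ^ (i * k)) ` {..d}" unfolding v_def by (intro Max_in) auto
  then obtain j where "j \<le> d" "v = \<bar>c j\<bar> * 2 ^ (j * k)" by auto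
  moreover have "\<bar>c i\<bar> * 2 ^ (i * k) \<le> v" if "i \<le> d" for i
    unfolding v_def using that by (intro Max_ge) auto
  ultimately have "?X \<noteq> {}" by auto
  from Max_in[OF fin this] have "dominant c d k \<in> ?X" unfolding dominant_def .
  then show "dominant c d k \<le> d"
    and "i \<le> d \<Longrightarrow> \<bar>c i\<bar> * 2 ^ (i * k) \<le> \<bar>c (dominant c d k)\<bar> * 2 ^ (dominant c d k * k)" by blast+
  show "j \<le> d \<Longrightarrow> (\<And>i. i \<le> d \<Longrightarrow> \<bar>c i\<bar> * 2 ^ (i * k) \<le> \<bar>c j\<bar> * 2 ^ (j * k)) \<Longrightarrow> j \<le> dominant c d k" for j
    unfolding dominant_def using fin by (intro Max_ge) auto
qed

text \<open>Raising the scale favours higher powers, so a maximiser at \<open>k\<close> still beats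
  every lower index at \<open>k'\<close>. Ties do no harm because the largest maximiser is
  chosen.\<close>

lemma dominant_mono:
  assumes "k \<le> k'" shows "dominant c d k \<le> dominant c d k'"
proof (rule ccontr)
  define j j' where "j = dominant c d k" and "j' = dominant c d k'"
  assume "\<not> dominant c d k \<le> dominant c d k'"
  then have less: "j' < j" by (simp add: j_def j'_def)
  obtain e where k': "k' = k + e" using assms le_Suc_ex by blast
  have "\<bar>c j'\<bar> * 2 ^ (j' * k) * 2 ^ (j' * e) \<le> \<bar>c j\<bar> * 2 ^ (j * k) * 2 ^ (j * e)"
    using dominant(2)[of j' d c k] dominant(1)[of c d k'] less
    by - (rule mult_mono, auto simp: j_def j'_def intro!: power_increasing mult_right_mono)
  then have *: "\<bar>c j'\<bar> * 2 ^ (j' * k') \<le> \<bar>c j\<bar> * 2 ^ (j * k')"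
    by (simp add: k' power_add algebra_simps)
  have "j \<le> j'" unfolding j'_def
  proof (rule dominant(3))
    show "j \<le> d" by (simp add: j_def dominant(1))
    fix i assume "i \<le> d"
    from dominant(2)[OF this, of c k'] show "\<bar>c i\<bar> * 2 ^ (i * k') \<le> \<bar>c j\<bar> * 2 ^ (j * k')"
      using * unfolding j'_def by linarith
  qed
  with less show False by simp
qed

text \<open>Terms of lower index are compared with term \<open>j\<close> at the left end
  \<open>k\<close>, those of higher index at the right end \<open>k + w\<close>. Moving inwards by
  at least \<open>d + 1\<close> gains a factor \<open>2 ^ (d + 1)\<close> over each, and the at most
  \<open>d\<close> other terms then add up to at most half.\<close>

lemma dominant_approx:
  assumes "dominant c d k = j" "dominant c d (k + w) = j" "d + 1 \<le> x" "x + (d + 1) \<le> w"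
    and t: "\<bar>t\<bar> = 2 ^ (k + x)"
  shows "\<bar>(\<Sum>i\<le>d. c i * t ^ i) - c j * t ^ j\<bar> \<le> \<bar>c j * t ^ j\<bar> / 2"
proof -
  define V where "V = \<bar>c j\<bar> * 2 ^ (j * (k + x))"
  have jd: "j \<le> d" using assms dominant(1) by blast
  have abs: "\<bar>c i * t ^ i\<bar> = \<bar>c i\<bar> * 2 ^ (i * (k + x))" for i
    by (simp add: abs_mult power_abs t power_mult[symmetric] mult.commute)
  have small: "\<bar>c i * t ^ i\<bar> * 2 ^ (d + 1) \<le> V" if i: "i \<le> d" "i \<noteq> j" for i
  proof (cases "i < j")
    case True
    have "i * x + (d + 1) \<le> j * x"
    proof -
      have "i * x + (d + 1) \<le> Suc i * x" using assms by simp
      also have "\<dots> \<le> j * x" using True by (intro mult_right_mono) auto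
      finally show ?thesis .
    qed
    then have "\<bar>c i\<bar> * 2 ^ (i * k) * 2 ^ (i * x + (d + 1)) \<le> \<bar>c j\<bar> * 2 ^ (j * k) * 2 ^ (j * x)"
      using dominant(2)[OF i(1), of c k] assms(1)
      by - (rule mult_mono, simp, rule power_increasing, auto)
    then show ?thesis unfolding abs V_def by (simp add: power_add algebra_simps)
  next
    case False
    then have ij: "j < i" using i by simp
    obtain y where w: "w = x + y" "d + 1 \<le> y" using assms by (metis add_le_cancel_left le_Suc_ex add_leD1)
    have "j * y + (d + 1) \<le> i * y"
    proof -
      have "j * y + (d + 1) \<le> Suc j * y" using w by simp
      also have "\<dots> \<le> i * y" using ij by (intro mult_right_mono) auto
      finally show ?thesis .
    qed
    then have "\<bar>c i\<bar> * 2 ^ (i * (k + x)) * 2 ^ (j * y + (d + 1)) \<le> \<bar>c i\<bar> * 2 ^ (i * (k + x)) * 2 ^ (i * y)"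
      by (intro mult_left_mono power_increasing) auto
    also have "\<dots> = \<bar>c i\<bar> * 2 ^ (i * (k + w))" by (simp add: w power_add algebra_simps)
    also have "\<dots> \<le> \<bar>c j\<bar> * 2 ^ (j * (k + w))" using dominant(2)[OF i(1), of c "k + w"] assms by simp
    also have "\<dots> = V * 2 ^ (j * y)" by (simp add: V_def w power_add algebra_simps)
    finally have "(\<bar>c i\<bar> * 2 ^ (i * (k + x)) * 2 ^ (d + 1)) * 2 ^ (j * y) \<le> V * 2 ^ (j * y)"
      by (simp add: power_add algebra_simps)
    then show ?thesis unfolding abs by simp
  qed
  have "(\<Sum>i\<le>d. c i * t ^ i) - c j * t ^ j = (\<Sum>i\<in>{..d} - {j}. c i * t ^ i)"
    using jd by (simp add: sum.remove[of "{..d}" j])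
  also have "\<bar>\<dots>\<bar> \<le> (\<Sum>i\<in>{..d} - {j}. \<bar>c i * t ^ i\<bar>)" by (rule sum_abs)
  also have "\<dots> \<le> (\<Sum>i\<in>{..d} - {j}. V / 2 ^ (d + 1))"
    using small by (intro sum_mono) (auto simp: field_simps)
  also have "\<dots> = real d * (V / 2 ^ (d + 1))" using jd by simp
  also have "\<dots> \<le> 2 ^ d * (V / 2 ^ (d + 1))"
    using of_nat_less_two_power[of d, where 'a = real]
    by (intro mult_right_mono) (auto simp: V_def)
  also have "\<dots> = \<bar>c j * t ^ j\<bar> / 2" unfolding abs V_def[symmetric] by simp
  finally show ?thesis .
qed

text \<open>Two different powers cannot stay comparable at both \<open>t\<close> and
  \<open>t * V\<close>: multiplying the two inequalities cancels the values at \<open>t\<close> and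
  leaves \<open>V ^ a \<le> 9 * G\<^sup>2 * V ^ b\<close>.\<close>

lemma gap_growth:
  fixes A B :: real
  assumes pos: "A > 0" "B > 0" "t > 0" "G > 0" "b < a" "V \<ge> 1"
    and "A * (t * V) ^ a \<le> 3 * G * (B * (t * V) ^ b)" "B * t ^ b \<le> 3 * G * (A * t ^ a)"
  shows "V \<le> 9 * G\<^sup>2"
proof -
  have "(A * (t * V) ^ a) * (B * t ^ b) \<le> (3 * G * (B * (t * V) ^ b)) * (3 * G * (A * t ^ a))"
    using assms by - (rule mult_mono, auto)
  then have "(A * B * t ^ a * t ^ b) * V ^ a \<le> (A * B * t ^ a * t ^ b) * (9 * G\<^sup>2 * V ^ b)"
    by (simp add: power_mult_distrib power2_eq_square algebra_simps)
  then have "V ^ a \<le> 9 * G\<^sup>2 * V ^ b" using pos by (simp add: mult_le_cancel_left)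
  moreover have "V ^ Suc b \<le> V ^ a" using assms by (intro power_increasing) auto
  ultimately have "V * V ^ b \<le> 9 * G\<^sup>2 * V ^ b" by simp
  then show ?thesis using assms by (simp add: mult_le_cancel_right)
qed

text \<open>
  On a long enough range of scales the dominant exponents of \<open>p\<close> and \<open>q\<close> are both constant;
  the sign pattern makes the first odd and the second even, so \<open>p / q\<close> behaves like a nonzero
  power of \<open>t\<close> there.
\<close>

lemma no_bounded_sign_ratio:
  fixes p q :: "real \<Rightarrow> real"
  assumes "poly_le d p" "poly_le d q" and G: "G > 0" "9 * G\<^sup>2 < 2 ^ v"
    and w: "w = v + 2 * (d + 1)"
    and sign: "\<And>k. ks \<le> k \<Longrightarrow> k \<le> ks + (2 * d + 1) * w \<Longrightarrow>
      p (2 ^ k) > 0 \<and> p (- (2 ^ k)) < 0 \<and> q (2 ^ k) > 0 \<and> q (- (2 ^ k)) > 0"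
    and ratio: "\<And>k. ks \<le> k \<Longrightarrow> k \<le> ks + (2 * d + 1) * w \<Longrightarrow>
      p (2 ^ k) \<le> G * q (2 ^ k) \<and> q (2 ^ k) \<le> G * p (2 ^ k)"
  shows False
proof -
  obtain e where e: "\<And>x. p x = (\<Sum>i\<le>d. e i * x ^ i)" using poly_le_altdef[OF assms(1)] by blast
  obtain f where f: "\<And>x. q x = (\<Sum>i\<le>d. f i * x ^ i)" using poly_le_altdef[OF assms(2)] by blast
  define S where "S = (\<lambda>r. dominant e d (ks + r * w) + dominant f d (ks + r * w))"
  have mono: "dominant c d (ks + r * w) \<le> dominant c d (ks + Suc r * w)" for c r
    by (rule dominant_mono) simp
  \<comment> \<open>Pigeonhole: \<open>S\<close> is nondecreasing and at most \<open>2 * d\<close>,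
    so it cannot grow in each of \<open>2 * d + 1\<close> steps. Where the sum stalls, both summands
    do, being monotone.\<close>
  have "\<exists>r\<le>2 * d. S r = S (Suc r)"
  proof (rule ccontr)
    assume *: "\<not> (\<exists>r\<le>2 * d. S r = S (Suc r))"
    have "r \<le> 2 * d + 1 \<Longrightarrow> r \<le> S r" for r
    proof (induction r)
      case (Suc r)
      then have "S r \<noteq> S (Suc r)" using * by simp
      moreover have "S r \<le> S (Suc r)" unfolding S_def using mono by (intro add_mono)
      ultimately show ?case using Suc by simp
    qed simp
    from this[of "2 * d + 1"] show False
      using dominant(1)[of e d "ks + (2 * d + 1) * w"] dominant(1)[of f d "ks + (2 * d + 1) * w"]
      by (simp add: S_def)
  qed
  then obtain r where r: "r \<le> 2 * d" "S r = S (Suc r)" by blast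
  define k where "k = ks + r * w"
  define a b where "a = dominant e d k" and "b = dominant f d k"
  have ab: "dominant e d (k + w) = a" "dominant f d (k + w) = b"
    using r(2) mono[of e r] mono[of f r]
    by (simp_all add: S_def a_def b_def k_def algebra_simps)
  have range: "ks \<le> k + x \<and> k + x \<le> ks + (2 * d + 1) * w" if "x \<le> w" for x
  proof -
    have "r * w + x \<le> (2 * d) * w + w" using r that by (intro add_mono mult_right_mono) auto
    then show ?thesis by (simp add: k_def)
  qed
  \<comment> \<open>Both offsets \<open>d + 1\<close> and \<open>d + 1 + v\<close> keep distance
    \<open>d + 1\<close> from the ends of the range, since
    \<open>w = v + 2 * (d + 1)\<close>.\<close>
  have P: "\<bar>p t - e a * t ^ a\<bar> \<le> \<bar>e a * t ^ a\<bar> / 2" and Q: "\<bar>q t - f b * t ^ b\<bar> \<le> \<bar>f b * t ^ b\<bar> / 2"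
    if "x \<in> {d + 1, d + 1 + v}" "\<bar>t\<bar> = 2 ^ (k + x)" for x t
    using dominant_approx[of e d k a w x t] dominant_approx[of f d k b w x t] ab that w
    by (auto simp: e f a_def b_def)
  define t :: real where "t = 2 ^ (k + (d + 1))"
  define V :: real where "V = 2 ^ v"
  have tpos: "t > 0" "V \<ge> 1" "t * V > 0" by (auto simp: t_def V_def)
  have tV: "t * V = 2 ^ (k + (d + 1 + v))" by (simp add: t_def V_def power_add)
  have sg: "p t > 0" "p (- t) < 0" "q t > 0" "q (- t) > 0"
    using sign[of "k + (d + 1)"] range[of "d + 1"] w by (auto simp: t_def)
  have rt: "p t \<le> G * q t" "q t \<le> G * p t"
    using ratio[of "k + (d + 1)"] range[of "d + 1"] w by (auto simp: t_def)
  have rtV: "p (t * V) \<le> G * q (t * V)" "q (t * V) \<le> G * p (t * V)"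
    using ratio[of "k + (d + 1 + v)"] range[of "d + 1 + v"] w unfolding tV by auto
  have abst: "\<bar>t\<bar> = 2 ^ (k + (d + 1))" "\<bar>- t\<bar> = 2 ^ (k + (d + 1))" by (auto simp: t_def)
  have Pt: "\<bar>p s - e a * s ^ a\<bar> \<le> \<bar>e a * s ^ a\<bar> / 2" and Qt: "\<bar>q s - f b * s ^ b\<bar> \<le> \<bar>f b * s ^ b\<bar> / 2"
    if "s \<in> {t, - t}" for s
    using that P[OF _ abst(1)] P[OF _ abst(2)] Q[OF _ abst(1)] Q[OF _ abst(2)] by auto
  have "e a * t ^ a > 0" using Pt[of t] sg by (auto simp: abs_if split: if_splits)
  then have ea: "e a > 0" using tpos by (simp add: zero_less_mult_iff)
  have "f b * t ^ b > 0" using Qt[of t] sg by (auto simp: abs_if split: if_splits)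
  then have fb: "f b > 0" using tpos by (simp add: zero_less_mult_iff)
  \<comment> \<open>A function within half of its leading term has the sign of that term, so the
    signs of \<open>p\<close> and \<open>q\<close> at \<open>- t\<close> decide the
    parities.\<close>
  have "odd a"
  proof
    assume "even a"
    then have "e a * (- t) ^ a > 0" using ea tpos by simp
    then show False using Pt[of "- t"] sg by (auto simp: abs_if split: if_splits)
  qed
  moreover have "even b"
  proof (rule ccontr)
    assume "odd b"
    then have "f b * (- t) ^ b < 0" using fb tpos by simp
    then show False using Qt[of "- t"] sg by (auto simp: abs_if split: if_splits)
  qed
  ultimately have "a \<noteq> b" by auto
  have bounds: "e a * s ^ a / 2 \<le> p s" "p s \<le> 3 / 2 * (e a * s ^ a)"
      "f b * s ^ b / 2 \<le> q s" "q s \<le> 3 / 2 * (f b * s ^ b)" if "s \<in> {t, t * V}" for s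
  proof -
    have "\<exists>x\<in>{d + 1, d + 1 + v}. \<bar>s\<bar> = 2 ^ (k + x)" "s > 0"
      using that tpos tV by (auto simp: t_def)
    moreover have "e a * s ^ a > 0" "f b * s ^ b > 0" using ea fb \<open>s > 0\<close> by auto
    ultimately have "\<bar>p s - e a * s ^ a\<bar> \<le> e a * s ^ a / 2" "\<bar>q s - f b * s ^ b\<bar> \<le> f b * s ^ b / 2"
      using P[of _ s] Q[of _ s] by fastforce+
    then show "e a * s ^ a / 2 \<le> p s" "p s \<le> 3 / 2 * (e a * s ^ a)"
      "f b * s ^ b / 2 \<le> q s" "q s \<le> 3 / 2 * (f b * s ^ b)" by linarith+
  qed
  \<comment> \<open>The factor 3 is the loss 2 from below times 3/2 from above when values are
    replaced by leading terms.\<close>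
  have comb: "X \<le> 3 * G * Y" if "X / 2 \<le> u" "u \<le> G * u'" "u' \<le> 3 / 2 * Y" for X Y u u' :: real
  proof -
    have "G * u' \<le> G * (3 / 2 * Y)" using that G by (intro mult_left_mono) auto
    then show ?thesis using that by (simp add: algebra_simps)
  qed
  \<comment> \<open>As the exponents differ, one of \<open>p / q\<close> and \<open>q / p\<close>
    grows with \<open>t\<close>; the two cases exchange the roles of \<open>p\<close> and
    \<open>q\<close>.\<close>
  have "V \<le> 9 * G\<^sup>2"
  proof (cases "b < a")
    case True
    show ?thesis
      by (rule gap_growth[OF ea fb tpos(1) G(1) True tpos(2)])
        (rule comb; use bounds[of t] bounds[of "t * V"] rt rtV in auto)+
  next
    case False
    then have "a < b" using \<open>a \<noteq> b\<close> by simp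
    show ?thesis
      by (rule gap_growth[OF fb ea tpos(1) G(1) \<open>a < b\<close> tpos(2)])
        (rule comb; use bounds[of t] bounds[of "t * V"] rt rtV in auto)+
  qed
  then show False using G by (simp add: V_def)
qed

section \<open>Drawing the blocks of the halfspace\<close>

lemma sum_Pow_by_card:
  fixes g :: "nat \<Rightarrow> real"
  assumes "finite A"
  shows "(\<Sum>T\<in>Pow A. g (card T) * f T) = (\<Sum>l\<le>card A. g l * (\<Sum>T | T \<subseteq> A \<and> card T = l. f T))"
proof -
  have "(\<Sum>T\<in>Pow A. g (card T) * f T) = (\<Sum>l\<le>card A. \<Sum>T | T \<in> Pow A \<and> card T = l. g (card T) * f T)"
    using assms by (intro sum.group[symmetric]) (auto intro: card_mono)
  also have "\<dots> = (\<Sum>l\<le>card A. g l * (\<Sum>T | T \<subseteq> A \<and> card T = l. f T))"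
    unfolding sum_distrib_left by (intro sum.cong) auto
  finally show ?thesis .
qed

text \<open>Chosen so that in state 0 the spline weights are centred at cardinality
  \<open>n / 2\<close>, that is, at block sum 0.\<close>

definition centre :: "nat \<Rightarrow> nat \<Rightarrow> real" where
  "centre n d = (real n - real d - 1) / 2"

text \<open>
  The blocks are drawn from the most significant one downwards.  The state \<open>u\<close> before block \<open>i\<close> is
  drawn is \<open>(\<Sum>j>i. 2 ^ j * z j - t) / 2 ^ (i + 1)\<close>, where \<open>z j\<close> is the sum of the entries of
  block \<open>j\<close> and \<open>t\<close> the value aimed at; the spline weight keeps \<open>u\<close> in the interval from
  \<open>- (d + 1)\<close> to \<open>d + 1\<close>.
\<close>

fun block_mean :: "nat \<Rightarrow> nat \<Rightarrow> nat \<Rightarrow> real \<Rightarrow> ((nat \<Rightarrow> nat set) \<Rightarrow> real) \<Rightarrow> real" where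
  "block_mean n d 0 u F = F (\<lambda>_. {})"
| "block_mean n d (Suc i) u F = (\<Sum>T\<in>Pow {1..n}.
     bspline d (u - centre n d + real (card T)) / real (n choose card T) *
     block_mean n d i (2 * (u - centre n d + real (card T)) - real (d + 1)) (\<lambda>X. F (X(Suc i := T))))"

lemma block_mean_sum:
  "block_mean n d i u (\<lambda>X. \<Sum>k\<in>K. c k * F k X) = (\<Sum>k\<in>K. c k * block_mean n d i u (F k))"
proof (induction i arbitrary: u F)
  case (Suc i)
  show ?case
    unfolding block_mean.simps Suc sum_distrib_left by (subst sum.swap) (simp only: mult_ac)
qed simp

lemma block_mean_cmult: "block_mean n d i u (\<lambda>X. c * F X) = c * block_mean n d i u F"
  using block_mean_sum[of n d i u "\<lambda>_. c" "\<lambda>_. F" "{()}"] by simp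

text \<open>For every admissible state the whole support of the spline lies over attainable
  cardinalities 0, ..., \<open>n\<close>; this is where \<open>n\<close> has to be at least
  \<open>3 * (d + 1)\<close>.\<close>

lemma centre_bounds:
  assumes "3 * (d + 1) \<le> n" "\<bar>u\<bar> \<le> real (d + 1)"
  shows "u - centre n d \<le> 0" "u - centre n d + real n \<ge> real d + 1"
proof -
  have "real (3 * (d + 1)) \<le> real n" using assms(1) by (simp only: of_nat_le_iff)
  then show "u - centre n d \<le> 0" "u - centre n d + real n \<ge> real d + 1"
    using assms(2) by (auto simp: centre_def field_simps abs_le_iff)
qed

text \<open>A draw of nonzero weight leads to a state that is admissible again.\<close>

lemma bspline_nonzero:
  assumes "bspline d x \<noteq> 0" shows "\<bar>2 * x - real (d + 1)\<bar> \<le> real (d + 1)"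
proof -
  have "0 \<le> x \<and> x \<le> real d + 1" using assms bspline_eq_0[of x d] by linarith
  then show ?thesis by (auto simp: abs_le_iff)
qed

text \<open>The quantity in the hypothesis on \<open>F\<close> is preserved by every draw and equals
  \<open>2 * u\<close> once all blocks are drawn, so only points satisfying the bound receive
  weight. The weights are nonnegative and do not all vanish.\<close>

lemma block_mean_pos:
  assumes n: "3 * (d + 1) \<le> n" and "\<bar>u\<bar> \<le> real (d + 1)"
    and "\<And>X. (\<And>j. X j \<subseteq> {1..n}) \<Longrightarrow>
      \<bar>(\<Sum>j=1..i. 2 ^ j * (2 * real (card (X j)) - real n)) + 2 ^ (i + 1) * u\<bar> \<le> 2 * real (d + 1) \<Longrightarrow> F X > 0"
  shows "block_mean n d i u F > 0"
  using assms(2,3)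
proof (induction i arbitrary: u F)
  case 0
  show ?case using 0(1) by (auto intro!: 0(2))
next
  case (Suc i)
  define v where "v = u - centre n d"
  note v = centre_bounds[OF n Suc.prems(1), folded v_def]
  define K where "K = (\<lambda>T :: nat set. bspline d (v + real (card T)) / real (n choose card T))"
  define E where "E = (\<lambda>T. block_mean n d i (2 * (v + real (card T)) - real (d + 1)) (\<lambda>X. F (X(Suc i := T))))"
  have E: "E T > 0" if T: "T \<subseteq> {1..n}" "K T \<noteq> 0" for T
    unfolding E_def
  proof (rule Suc.IH)
    show "\<bar>2 * (v + real (card T)) - real (d + 1)\<bar> \<le> real (d + 1)"
      using T(2) by (intro bspline_nonzero) (auto simp: K_def)
    fix X :: "nat \<Rightarrow> nat set"
    assume X: "\<And>j. X j \<subseteq> {1..n}" and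
      *: "\<bar>(\<Sum>j=1..i. 2 ^ j * (2 * real (card (X j)) - real n)) +
            2 ^ (i + 1) * (2 * (v + real (card T)) - real (d + 1))\<bar> \<le> 2 * real (d + 1)"
    have eq: "(\<Sum>j=1..Suc i. 2 ^ j * (2 * real (card ((X(Suc i := T)) j)) - real n)) =
          (\<Sum>j=1..i. 2 ^ j * (2 * real (card (X j)) - real n)) + 2 ^ Suc i * (2 * real (card T) - real n)"
      by (auto intro!: sum.cong)
    show "F (X(Suc i := T)) > 0"
    proof (rule Suc.prems(2))
      show "(X(Suc i := T)) j \<subseteq> {1..n}" for j using X T by auto
      show "\<bar>(\<Sum>j=1..Suc i. 2 ^ j * (2 * real (card ((X(Suc i := T)) j)) - real n)) + 2 ^ (Suc i + 1) * u\<bar>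
              \<le> 2 * real (d + 1)"
      proof -
        \<comment> \<open>The new state is twice the old one plus the block sum:
          \<open>centre\<close> and the shift by \<open>d + 1\<close> cancel.\<close>
        have "2 ^ (i + 1) * (2 * (v + real (card T)) - real (d + 1)) =
            2 ^ Suc i * (2 * real (card T) - real n) + 2 ^ (Suc i + 1) * u"
          by (simp add: v_def centre_def field_simps)
        then show ?thesis unfolding eq using * by (simp only: add.assoc)
      qed
    qed
  qed
  have Knn: "K T \<ge> 0" for T by (simp add: K_def bspline_nonneg)
  \<comment> \<open>Dividing by \<open>n choose card T\<close> spreads the weight of a cardinality
    evenly over its sets, which leaves a plain lattice sum.\<close>
  have "(\<Sum>T\<in>Pow {1..n}. K T) = (\<Sum>l\<le>n. bspline d (v + real l))"
  proof -
    have "(\<Sum>T\<in>Pow {1..n}. K T) = (\<Sum>l\<le>n. bspline d (v + real l) / real (n choose l) *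
        (\<Sum>T | T \<subseteq> {1..n} \<and> card T = l. 1))"
      using sum_Pow_by_card[of "{1..n}" "\<lambda>l. bspline d (v + real l) / real (n choose l)" "\<lambda>_. 1"]
      by (simp add: K_def)
    then show ?thesis by (simp add: n_subsets)
  qed
  also have "\<dots> = 1" using v by (intro bspline_sum_eq_1) auto
  finally have "\<exists>T\<in>Pow {1..n}. K T \<noteq> 0" by (metis sum.neutral zero_neq_one)
  then obtain T where T: "T \<in> Pow {1..n}" "K T \<noteq> 0" by blast
  have "(\<Sum>T\<in>Pow {1..n}. K T * E T) > 0"
  proof (rule sum_pos2[OF _ T(1)])
    show "0 < K T * E T" using T E[of T] Knn[of T] by (auto intro!: mult_pos_pos simp: less_le)
    show "0 \<le> K T * E T" if "T \<in> Pow {1..n}" for T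
      using that E[of T] Knn[of T] by (cases "K T = 0") auto
  qed auto
  then show ?case by (simp add: K_def E_def v_def)
qed

text \<open>Averaging block \<open>Suc i\<close> over each level turns its character into a
  polynomial \<open>A\<close> in the cardinality, and the remaining blocks contribute a polynomial
  \<open>F\<close> in the new state. The degrees sum to at most \<open>d\<close>, so
  \<open>bspline_mixed_moment\<close> applies.\<close>

lemma block_mean_character:
  assumes n: "3 * (d + 1) \<le> n" and S: "\<And>j. S j \<subseteq> {1..n}" and "(\<Sum>j=1..i. card (S j)) \<le> d"
  shows "\<exists>F. poly_le (\<Sum>j=1..i. card (S j)) F \<and> (\<forall>u. \<bar>u\<bar> \<le> real (d + 1) \<longrightarrow>
     block_mean n d i u (\<lambda>X. \<Prod>j=1..i. character (S j) (X j)) = F u)"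
  using assms(3)
proof (induction i)
  case 0
  then show ?case by (auto intro!: exI[of _ "\<lambda>_. 1"] poly_le_const)
next
  case (Suc i)
  define e where "e = (\<Sum>j=1..i. card (S j))"
  have deg: "card (S (Suc i)) + e \<le> d" using Suc.prems by (simp add: e_def)
  then obtain F where F: "poly_le e F" "\<And>u. \<bar>u\<bar> \<le> real (d + 1) \<Longrightarrow>
      block_mean n d i u (\<lambda>X. \<Prod>j=1..i. character (S j) (X j)) = F u"
    using Suc by (auto simp: e_def)
  obtain A where A: "poly_le (card (S (Suc i))) A" "\<And>l. l \<le> n \<Longrightarrow>
     (\<Sum>T | T \<subseteq> {1..n} \<and> card T = l. character (S (Suc i)) T) = real (n choose l) * A (real l)"
    using symmetrization[of "{1..n}" "S (Suc i)"] S by auto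
  have "poly_le e (\<lambda>x. F (2 * x - real (d + 1)))"
    using poly_le_compose_linear[OF F(1), of "- real (d + 1)" 2] by (simp add: algebra_simps)
  from bspline_mixed_moment[OF A(1) this deg] obtain H where H: "poly_le (card (S (Suc i))) H"
    "\<And>a N. a \<le> 0 \<Longrightarrow> a + real N \<ge> real d + 1 \<Longrightarrow> (\<Sum>l\<le>N. bspline d (a + real l) *
       (A (real l) * F (2 * (a + real l) - real (d + 1)))) = H a"
    by blast
  have "block_mean n d (Suc i) u (\<lambda>X. \<Prod>j=1..Suc i. character (S j) (X j)) = H (u - centre n d)"
    if u: "\<bar>u\<bar> \<le> real (d + 1)" for u
  proof -
    define v where "v = u - centre n d"
    note v = centre_bounds[OF n u, folded v_def]
    define g where "g = (\<lambda>l. bspline d (v + real l) / real (n choose l) * F (2 * (v + real l) - real (d + 1)))"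
    have prod: "(\<Prod>j=1..Suc i. character (S j) ((X(Suc i := T)) j)) =
        character (S (Suc i)) T * (\<Prod>j=1..i. character (S j) (X j))" for X T
      by (simp add: mult.commute)
    have "block_mean n d (Suc i) u (\<lambda>X. \<Prod>j=1..Suc i. character (S j) (X j)) =
       (\<Sum>T\<in>Pow {1..n}. g (card T) * character (S (Suc i)) T)"
      unfolding block_mean.simps prod block_mean_cmult v_def[symmetric]
    proof (intro sum.cong refl)
      \<comment> \<open>\<open>F\<close> describes the remaining mean only in admissible states;
        elsewhere the weight is 0 and both sides vanish.\<close>
      fix T assume "T \<in> Pow {1..n}"
      show "bspline d (v + real (card T)) / real (n choose card T) *
         (character (S (Suc i)) T * block_mean n d i (2 * (v + real (card T)) - real (d + 1))
            (\<lambda>X. \<Prod>j=1..i. character (S j) (X j))) = g (card T) * character (S (Suc i)) T"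
        using F(2)[OF bspline_nonzero, of "v + real (card T)"]
        by (cases "bspline d (v + real (card T)) = 0") (auto simp: g_def)
    qed
    also have "\<dots> = (\<Sum>l\<le>n. g l * (\<Sum>T | T \<subseteq> {1..n} \<and> card T = l. character (S (Suc i)) T))"
      by (subst sum_Pow_by_card) auto
    also have "\<dots> = (\<Sum>l\<le>n. bspline d (v + real l) * (A (real l) * F (2 * (v + real l) - real (d + 1))))"
      using A(2) by (intro sum.cong refl) (auto simp: g_def)
    also have "\<dots> = H v" using H(2)[OF v] .
    finally show ?thesis by (simp add: v_def)
  qed
  moreover have "poly_le (\<Sum>j=1..Suc i. card (S j)) (\<lambda>u. H (u - centre n d))"
    using poly_le_mono[OF poly_le_compose_linear[OF H(1), of "- centre n d" 1]] by simp
  ultimately show ?case by (intro exI[of _ "\<lambda>u. H (u - centre n d)"]) blast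
qed

section \<open>The lower bound\<close>

lemma monomial_degree_le:
  "m \<in> Poly_Mapping.keys p \<Longrightarrow> monomial_degree m \<le> total_degree p"
  unfolding total_degree_def by (intro Max_ge) auto

lemma total_degree_le_iff:
  "total_degree p \<le> d \<longleftrightarrow> (\<forall>m\<in>Poly_Mapping.keys p. monomial_degree m \<le> d)"
  unfolding total_degree_def by (subst Max_le_iff) auto

text \<open>Blocks and majority part are given by their sets of positive coordinates;
  \<open>undefined\<close> outside makes the point extensional, as \<open>sign_cube\<close>
  demands.\<close>

definition cube_point :: "nat \<Rightarrow> nat \<Rightarrow> (nat \<Rightarrow> nat set) \<Rightarrow> nat set \<Rightarrow> (nat \<times> nat) + nat \<Rightarrow> real" where
  "cube_point n m X Y = (\<lambda>v. if v \<in> ({1..n} \<times> {1..n}) <+> {1..m} then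
     (case v of Inl (i, j) \<Rightarrow> if j \<in> X i then 1 else - 1 | Inr j \<Rightarrow> if j \<in> Y then 1 else - 1)
     else undefined)"

lemma cube_point_simps:
  "i \<in> {1..n} \<Longrightarrow> j \<in> {1..n} \<Longrightarrow> cube_point n m X Y (Inl (i, j)) = (if j \<in> X i then 1 else - 1)"
  "j \<in> {1..m} \<Longrightarrow> cube_point n m X Y (Inr j) = (if j \<in> Y then 1 else - 1)"
  by (auto simp: cube_point_def)

lemma cube_point_in_sign_cube: "cube_point n m X Y \<in> sign_cube (({1..n} \<times> {1..n}) <+> {1..m})"
  unfolding sign_cube_def by (rule PiE_I) (simp_all add: cube_point_def split: sum.split prod.split)

lemma sign_cube_cases:
  assumes "z \<in> sign_cube (({1..n} \<times> {1..n}) <+> {1..m})"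
  obtains X Y where "\<And>i. X i \<subseteq> {1..n}" "Y \<subseteq> {1..m}" "z = cube_point n m X Y"
proof
  show "{j \<in> {1..n}. z (Inl (i, j)) = 1} \<subseteq> {1..n}" "{j \<in> {1..m}. z (Inr j) = 1} \<subseteq> {1..m}" for i
    by auto
  show "z = cube_point n m (\<lambda>i. {j \<in> {1..n}. z (Inl (i, j)) = 1}) {j \<in> {1..m}. z (Inr j) = 1}"
  proof
    fix v
    show "z v = cube_point n m (\<lambda>i. {j \<in> {1..n}. z (Inl (i, j)) = 1}) {j \<in> {1..m}. z (Inr j) = 1} v"
    proof (cases "v \<in> ({1..n} \<times> {1..n}) <+> {1..m}")
      case True
      then have "z v \<in> {- 1, 1}" using assms by (auto simp: sign_cube_def)
      with True show ?thesis by (auto simp: cube_point_def)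
    next
      case False
      then show ?thesis using assms by (auto simp: cube_point_def sign_cube_def PiE_def extensional_def)
    qed
  qed
qed

lemma sum_signs:
  assumes "T \<subseteq> {1..n}"
  shows "(\<Sum>j=1..n. if j \<in> T then 1 else - 1 :: real) = 2 * real (card T) - real n"
proof -
  have "(\<Sum>j=1..n. if j \<in> T then 1 else - 1 :: real) = (\<Sum>j=1..n. 2 * of_bool (j \<in> T) - 1)"
    by (intro sum.cong) auto
  also have "\<dots> = 2 * real (card ({1..n} \<inter> T)) - real n"
    by (simp add: sum_subtractf sum_distrib_left[symmetric] Int_def)
  also have "{1..n} \<inter> T = T" using assms by auto
  finally show ?thesis .
qed

lemma halfspace_form_cube_point:
  assumes "\<And>i. X i \<subseteq> {1..n}"
  shows "(\<Sum>i=1..n. \<Sum>j=1..n. 2 ^ i * cube_point n m X Y (Inl (i, j))) =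
     (\<Sum>i=1..n. 2 ^ i * (2 * real (card (X i)) - real n))"
proof (intro sum.cong refl)
  fix i assume "i \<in> {1..n}"
  then have "(\<Sum>j=1..n. 2 ^ i * cube_point n m X Y (Inl (i, j))) = 2 ^ i * (\<Sum>j=1..n. if j \<in> X i then 1 else - 1)"
    unfolding sum_distrib_left by (intro sum.cong refl) (simp only: cube_point_simps)
  then show "(\<Sum>j=1..n. 2 ^ i * cube_point n m X Y (Inl (i, j))) = 2 ^ i * (2 * real (card (X i)) - real n)"
    by (simp only: sum_signs[OF assms])
qed

lemma majority_form_cube_point:
  assumes "Y \<subseteq> {1..m}"
  shows "(\<Sum>j=1..m. cube_point n m X Y (Inr j)) = 2 * real (card Y) - real m"
  unfolding sum_signs[OF assms, symmetric] by (intro sum.cong refl) (simp only: cube_point_simps)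

text \<open>\<open>sign_and\<close> returns 1 unless both arguments are -1, and \<open>sgn 0\<close>
  is 0, so a vanishing form is counted with the positive ones.\<close>

lemma fun_and_cube_point:
  assumes "\<And>i. X i \<subseteq> {1..n}" "Y \<subseteq> {1..m}"
  shows "fun_and (weighted_halfspace n) (majority m) (cube_point n m X Y) =
    (if m < 2 * card Y \<or> 1 + (\<Sum>i=1..n. 2 ^ i * (2 * real (card (X i)) - real n)) \<ge> 0 then 1 else - 1)"
proof -
  have "majority m (cube_point n m X Y \<circ> Inr) = (if m < 2 * card Y then 1 else - 1)"
    using majority_form_cube_point[OF assms(2), of n X] by (simp add: majority_def)
  moreover have "weighted_halfspace n (cube_point n m X Y \<circ> Inl) =
      sgn (1 + (\<Sum>i=1..n. 2 ^ i * (2 * real (card (X i)) - real n)))"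
    using halfspace_form_cube_point[where X = X and m = m and Y = Y, OF assms(1)] by (simp add: weighted_halfspace_def)
  ultimately show ?thesis
    unfolding fun_and_def sign_and_def by (auto simp: sgn_if)
qed

definition odd_row :: "((nat \<times> nat) + nat) monomial \<Rightarrow> nat \<Rightarrow> nat set" where
  "odd_row mon i = {j. odd (Poly_Mapping.lookup mon (Inl (i, j)))}"

definition odd_tail :: "((nat \<times> nat) + nat) monomial \<Rightarrow> nat set" where
  "odd_tail mon = {j. odd (Poly_Mapping.lookup mon (Inr j))}"

text \<open>Squares of coordinates are 1, so only the variables of odd exponent survive, and each of
  them contributes at least 1 to the degree.\<close>

lemma monomial_on_cube:
  assumes "Poly_Mapping.keys mon \<subseteq> ({1..n} \<times> {1..n}) <+> {1..m}"
  shows "odd_row mon i \<subseteq> {1..n}" "odd_tail mon \<subseteq> {1..m}"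
    and "(\<Sum>i=1..n. card (odd_row mon i)) + card (odd_tail mon) \<le> monomial_degree mon"
    and "monomial_eval mon (cube_point n m X Y) =
       (\<Prod>i=1..n. character (odd_row mon i) (X i)) * character (odd_tail mon) Y"
proof -
  define R where "R = {v \<in> Poly_Mapping.keys mon. odd (Poly_Mapping.lookup mon v)}"
  have odd_key: "v \<in> ({1..n} \<times> {1..n}) <+> {1..m}" if "odd (Poly_Mapping.lookup mon v)" for v
  proof -
    have "v \<in> Poly_Mapping.keys mon" using that by (auto simp: in_keys_iff odd_pos)
    then show ?thesis using assms by blast
  qed
  show row: "odd_row mon i \<subseteq> {1..n}" for i
    unfolding odd_row_def using odd_key[of "Inl (i, _)"] by blast
  show tail: "odd_tail mon \<subseteq> {1..m}"
    unfolding odd_tail_def using odd_key[of "Inr _"] by blast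
  have fin: "finite (odd_row mon i)" "finite (odd_tail mon)" for i
    using row tail by (auto intro: finite_subset)
  have "R = {v. odd (Poly_Mapping.lookup mon v)}" by (auto simp: R_def in_keys_iff odd_pos)
  also have "\<dots> = Inl ` Sigma {1..n} (odd_row mon) \<union> Inr ` odd_tail mon"
  proof (intro equalityI subsetI)
    fix v assume "v \<in> {v. odd (Poly_Mapping.lookup mon v)}"
    then show "v \<in> Inl ` Sigma {1..n} (odd_row mon) \<union> Inr ` odd_tail mon"
      using odd_key[of v] by (cases v) (auto simp: odd_row_def odd_tail_def)
  qed (auto simp: odd_row_def odd_tail_def)
  finally have R: "R = Inl ` Sigma {1..n} (odd_row mon) \<union> Inr ` odd_tail mon" .
  have finR: "finite R" by (simp add: R_def)
  have "(\<Sum>i=1..n. card (odd_row mon i)) + card (odd_tail mon) = card R"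
    unfolding R using fin by (subst card_Un_disjoint) (auto simp: card_image)
  also have "card R = (\<Sum>v\<in>R. 1)" by simp
  also have "\<dots> \<le> (\<Sum>v\<in>R. Poly_Mapping.lookup mon v)"
    by (intro sum_mono) (auto simp: R_def odd_pos Suc_leI)
  also have "\<dots> \<le> monomial_degree mon"
    unfolding monomial_degree_def by (intro sum_mono2) (auto simp: R_def)
  finally show "(\<Sum>i=1..n. card (odd_row mon i)) + card (odd_tail mon) \<le> monomial_degree mon" .
  define z where "z = cube_point n m X Y"
  have "z v ^ Poly_Mapping.lookup mon v = (if odd (Poly_Mapping.lookup mon v) then z v else 1)"
    if "v \<in> Poly_Mapping.keys mon" for v
  proof -
    have "z v \<in> {- 1, 1}" using that assms cube_point_in_sign_cube[of n m X Y]
      by (auto simp: z_def sign_cube_def)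
    then show ?thesis by (auto elim!: oddE)
  qed
  then have "monomial_eval mon z = (\<Prod>v\<in>Poly_Mapping.keys mon. if odd (Poly_Mapping.lookup mon v) then z v else 1)"
    unfolding monomial_eval_def by (rule prod.cong[OF refl])
  also have "\<dots> = (\<Prod>v\<in>R. z v)" unfolding R_def by (rule prod.inter_filter[symmetric]) simp
  also have "\<dots> = (\<Prod>v\<in>Inl ` Sigma {1..n} (odd_row mon). z v) * (\<Prod>v\<in>Inr ` odd_tail mon. z v)"
    unfolding R using fin by (intro prod.union_disjoint) auto
  also have "(\<Prod>v\<in>Inr ` odd_tail mon. z v) = character (odd_tail mon) Y"
    unfolding character_def using tail
    by (subst prod.reindex) (auto simp: z_def intro!: prod.cong cube_point_simps)
  also have "(\<Prod>v\<in>Inl ` Sigma {1..n} (odd_row mon). z v) = (\<Prod>i=1..n. \<Prod>j\<in>odd_row mon i. z (Inl (i, j)))"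
    using fin by (subst prod.reindex) (auto simp: prod.Sigma split_def)
  also have "\<dots> = (\<Prod>i=1..n. character (odd_row mon i) (X i))"
    unfolding character_def z_def
    by (intro prod.cong refl cube_point_simps) (assumption | erule subsetD[OF row])+
  finally show "monomial_eval mon (cube_point n m X Y) =
       (\<Prod>i=1..n. character (odd_row mon i) (X i)) * character (odd_tail mon) Y" by (simp add: z_def)
qed

text \<open>
  The average of the polynomial over all points whose majority part has \<open>l\<close> positive entries and
  whose halfspace part is drawn around the value \<open>t\<close>.
\<close>

definition level_mean :: "((nat \<times> nat) + nat) rpoly \<Rightarrow> nat \<Rightarrow> nat \<Rightarrow> nat \<Rightarrow> real \<Rightarrow> nat \<Rightarrow> real" where
  "level_mean p n m d t l = block_mean n d n (- t / 2 ^ (n + 1))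
     (\<lambda>X. \<Sum>Y | Y \<subseteq> {1..m} \<and> card Y = l. 1 / real (m choose l) * poly_eval p (cube_point n m X Y))"

text \<open>Each monomial splits into a block part, whose mean is a polynomial in the initial state,
  and a majority part, whose level average is a polynomial in \<open>l\<close>. The bound on
  \<open>t\<close> makes the initial state admissible.\<close>

lemma level_mean_bivariate:
  assumes n: "3 * (d + 1) \<le> n" and p: "poly_vars p \<subseteq> ({1..n} \<times> {1..n}) <+> {1..m}" "total_degree p \<le> d"
  obtains P where "\<And>l. poly_le d (\<lambda>t. P t l)" "\<And>t. poly_le d (P t)"
    "\<And>t l. \<bar>t\<bar> \<le> 2 ^ n \<Longrightarrow> l \<le> m \<Longrightarrow> level_mean p n m d t l = P t (real l)"
proof -
  let ?K = "Poly_Mapping.keys p"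
  have sub: "Poly_Mapping.keys mon \<subseteq> ({1..n} \<times> {1..n}) <+> {1..m}" if "mon \<in> ?K" for mon
    using that p(1) by (auto simp: poly_vars_def)
  note mon = monomial_on_cube[OF sub]
  have deg: "(\<Sum>i=1..n. card (odd_row mon i)) \<le> d" "card (odd_tail mon) \<le> d" if "mon \<in> ?K" for mon
    using mon(3)[OF that] p(2) monomial_degree_le[OF that] by auto
  have "\<forall>mon\<in>?K. \<exists>A. poly_le d A \<and> (\<forall>l\<le>m.
     (\<Sum>Y | Y \<subseteq> {1..m} \<and> card Y = l. character (odd_tail mon) Y) = real (m choose l) * A (real l))"
  proof
    fix mon assume k: "mon \<in> ?K"
    obtain A where "poly_le (card (odd_tail mon)) A" "\<And>l. l \<le> m \<Longrightarrow>
      (\<Sum>Y | Y \<subseteq> {1..m} \<and> card Y = l. character (odd_tail mon) Y) = real (m choose l) * A (real l)"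
      using symmetrization[of "{1..m}" "odd_tail mon"] mon(2)[OF k] by auto
    then show "\<exists>A. poly_le d A \<and> (\<forall>l\<le>m.
     (\<Sum>Y | Y \<subseteq> {1..m} \<and> card Y = l. character (odd_tail mon) Y) = real (m choose l) * A (real l))"
      using poly_le_mono deg(2)[OF k] by blast
  qed
  from bchoice[OF this] obtain A where A: "\<And>mon. mon \<in> ?K \<Longrightarrow> poly_le d (A mon)"
    "\<And>mon l. mon \<in> ?K \<Longrightarrow> l \<le> m \<Longrightarrow>
      (\<Sum>Y | Y \<subseteq> {1..m} \<and> card Y = l. character (odd_tail mon) Y) = real (m choose l) * A mon (real l)"
    by blast
  have "\<forall>mon\<in>?K. \<exists>F. poly_le d F \<and> (\<forall>u. \<bar>u\<bar> \<le> real (d + 1) \<longrightarrow>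
     block_mean n d n u (\<lambda>X. \<Prod>i=1..n. character (odd_row mon i) (X i)) = F u)"
  proof
    fix mon assume k: "mon \<in> ?K"
    from block_mean_character[OF n mon(1)[OF k] deg(1)[OF k]]
    show "\<exists>F. poly_le d F \<and> (\<forall>u. \<bar>u\<bar> \<le> real (d + 1) \<longrightarrow>
     block_mean n d n u (\<lambda>X. \<Prod>i=1..n. character (odd_row mon i) (X i)) = F u)"
      using poly_le_mono[OF _ deg(1)[OF k]] by blast
  qed
  from bchoice[OF this] obtain F where F: "\<And>mon. mon \<in> ?K \<Longrightarrow> poly_le d (F mon)"
    "\<And>mon u. mon \<in> ?K \<Longrightarrow> \<bar>u\<bar> \<le> real (d + 1) \<Longrightarrow>
      block_mean n d n u (\<lambda>X. \<Prod>i=1..n. character (odd_row mon i) (X i)) = F mon u"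
    by blast
  \<comment> \<open>The argument of \<open>F mon\<close> is the initial state, in the shape required
    by \<open>poly_le_compose_linear\<close>.\<close>
  define P where "P = (\<lambda>t l. \<Sum>mon\<in>?K. Poly_Mapping.lookup p mon * A mon l * F mon (0 + (- 1 / 2 ^ (n + 1)) * t))"
  show thesis
  proof
    show "poly_le d (\<lambda>t. P t l)" for l
      unfolding P_def by (intro poly_le_sum poly_le_cmult poly_le_compose_linear F(1))
    show "poly_le d (P t)" for t
    proof -
      have "P t = (\<lambda>l. \<Sum>mon\<in>?K. (Poly_Mapping.lookup p mon * F mon (0 + (- 1 / 2 ^ (n + 1)) * t)) * A mon l)"
        by (auto simp: P_def mult_ac)
      moreover have "poly_le d \<dots>" by (intro poly_le_sum poly_le_cmult A(1))
      ultimately show ?thesis by (simp only:)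
    qed
    fix t :: real and l
    assume t: "\<bar>t\<bar> \<le> 2 ^ n" and l: "l \<le> m"
    define u where "u = - t / 2 ^ (n + 1)"
    have "\<bar>u\<bar> \<le> 1" using t by (simp add: u_def field_simps)
    then have u: "\<bar>u\<bar> \<le> real (d + 1)" by linarith
    have "(\<Sum>Y | Y \<subseteq> {1..m} \<and> card Y = l. 1 / real (m choose l) * poly_eval p (cube_point n m X Y)) =
       (\<Sum>mon\<in>?K. (Poly_Mapping.lookup p mon * A mon (real l)) * (\<Prod>i=1..n. character (odd_row mon i) (X i)))" for X
    proof -
      have "(\<Sum>Y | Y \<subseteq> {1..m} \<and> card Y = l. 1 / real (m choose l) * poly_eval p (cube_point n m X Y)) =
        (\<Sum>Y | Y \<subseteq> {1..m} \<and> card Y = l. \<Sum>mon\<in>?K. 1 / real (m choose l) *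
           (Poly_Mapping.lookup p mon * ((\<Prod>i=1..n. character (odd_row mon i) (X i)) * character (odd_tail mon) Y)))"
        unfolding poly_eval_def sum_distrib_left using mon(4) by (intro sum.cong refl) simp
      also have "\<dots> = (\<Sum>mon\<in>?K. 1 / real (m choose l) *
           (Poly_Mapping.lookup p mon * ((\<Prod>i=1..n. character (odd_row mon i) (X i)) *
              (\<Sum>Y | Y \<subseteq> {1..m} \<and> card Y = l. character (odd_tail mon) Y))))"
        unfolding sum_distrib_left by (rule sum.swap)
      also have "\<dots> = (\<Sum>mon\<in>?K. (Poly_Mapping.lookup p mon * A mon (real l)) * (\<Prod>i=1..n. character (odd_row mon i) (X i)))"
        using l by (intro sum.cong refl) (simp only: A(2), simp)
      finally show ?thesis .
    qed
    then have "level_mean p n m d t l =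
       (\<Sum>mon\<in>?K. (Poly_Mapping.lookup p mon * A mon (real l)) *
          block_mean n d n u (\<lambda>X. \<Prod>i=1..n. character (odd_row mon i) (X i)))"
      unfolding level_mean_def u_def[symmetric] block_mean_sum[symmetric] by simp
    also have "\<dots> = P t (real l)"
    proof -
      have "0 + (- 1 / 2 ^ (n + 1)) * t = u" by (simp add: u_def)
      then show ?thesis unfolding P_def using F(2)[OF _ u] by (intro sum.cong refl) (simp only:)
    qed
    finally show "level_mean p n m d t l = P t (real l)" .
  qed
qed

text \<open>The factor \<open>s\<close> treats both signs at once; the points that receive weight
  are those of \<open>block_mean_pos\<close>, with \<open>t\<close> as the value aimed at.\<close>

lemma level_mean_pos:
  assumes n: "3 * (d + 1) \<le> n" and t: "\<bar>t\<bar> \<le> 2 ^ n" and l: "l \<le> m"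
    and pos: "\<And>X Y. (\<And>i. X i \<subseteq> {1..n}) \<Longrightarrow> Y \<subseteq> {1..m} \<Longrightarrow> card Y = l \<Longrightarrow>
      \<bar>(\<Sum>i=1..n. 2 ^ i * (2 * real (card (X i)) - real n)) - t\<bar> \<le> 2 * real (d + 1) \<Longrightarrow>
      s * poly_eval p (cube_point n m X Y) > 0"
  shows "s * level_mean p n m d t l > 0"
  unfolding level_mean_def block_mean_cmult[symmetric]
proof (rule block_mean_pos[OF n])
  have "\<bar>- t / 2 ^ (n + 1)\<bar> \<le> 1" using t by (simp add: field_simps)
  then show "\<bar>- t / 2 ^ (n + 1)\<bar> \<le> real (d + 1)" by linarith
  fix X :: "nat \<Rightarrow> nat set"
  assume X: "\<And>j. X j \<subseteq> {1..n}"
    "\<bar>(\<Sum>j=1..n. 2 ^ j * (2 * real (card (X j)) - real n)) + 2 ^ (n + 1) * (- t / 2 ^ (n + 1))\<bar> \<le> 2 * real (d + 1)"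
  have card: "card {Y. Y \<subseteq> {1..m} \<and> card Y = l} = m choose l" by (simp add: n_subsets)
  then have ne: "{Y. Y \<subseteq> {1..m} \<and> card Y = l} \<noteq> {}" using l by (metis card.empty binomial_eq_0_iff not_less)
  have "(\<Sum>Y | Y \<subseteq> {1..m} \<and> card Y = l. s * (1 / real (m choose l) * poly_eval p (cube_point n m X Y))) > 0"
  proof (rule sum_pos[OF _ ne])
    fix Y assume "Y \<in> {Y. Y \<subseteq> {1..m} \<and> card Y = l}"
    then have "s * poly_eval p (cube_point n m X Y) > 0" using X by (intro pos) auto
    then have "1 / real (m choose l) * (s * poly_eval p (cube_point n m X Y)) > 0"
      using l by - (rule mult_pos_pos, simp_all)
    then show "s * (1 / real (m choose l) * poly_eval p (cube_point n m X Y)) > 0" by (simp only: mult_ac)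
  qed auto
  then show "s * (\<Sum>Y | Y \<subseteq> {1..m} \<and> card Y = l. 1 / real (m choose l) * poly_eval p (cube_point n m X Y)) > 0"
    by (simp only: sum_distrib_left)
qed

text \<open>At these scales \<open>2 ^ k\<close> outweighs the spread \<open>2 * (d + 1)\<close> of
  the weighted sum and the constant 1 of the halfspace.\<close>

lemma two_power_gt:
  assumes "d + 2 \<le> k"
  shows "2 * real (d + 1) + 1 < 2 ^ k"
proof -
  have "(2::real) ^ (d + 2) \<le> 2 ^ k" using assms by (intro power_increasing) auto
  moreover have "real (d + 1) \<le> 2 ^ d"
    using of_nat_le_iff[of "d + 1" "2 ^ d", where 'a = real] Suc_leI[OF less_exp[of d]] by simp
  ultimately show ?thesis by simp
qed

text \<open>\<open>2 * d < m\<close> puts at least \<open>d + 1\<close> levels on each side of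
  \<open>m / 2\<close>; the last hypothesis fits \<open>2 * d + 1\<close> ranges of scales, each of
  length at most \<open>7 * m + 6\<close>, between \<open>d + 2\<close> and
  \<open>n\<close>.\<close>

lemma total_degree_gt:
  assumes sr: "sign_represents (({1..n} \<times> {1..n}) <+> {1..m}) p (fun_and (weighted_halfspace n) (majority m))"
    and dm: "2 * d < m" and n: "3 * (d + 1) \<le> n" and big: "(d + 2) + (2 * d + 1) * (7 * m + 6) \<le> n"
  shows "total_degree p > d"
proof (rule ccontr)
  assume "\<not> total_degree p > d"
  then have deg: "total_degree p \<le> d" by simp
  obtain P where P: "\<And>l. poly_le d (\<lambda>t. P t l)" "\<And>t. poly_le d (P t)"
    "\<And>t l. \<bar>t\<bar> \<le> 2 ^ n \<Longrightarrow> l \<le> m \<Longrightarrow> level_mean p n m d t l = P t (real l)"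
    using level_mean_bivariate[OF n _ deg] sr unfolding sign_represents_def by blast
  have val: "fun_and (weighted_halfspace n) (majority m) (cube_point n m X Y) * poly_eval p (cube_point n m X Y) > 0" for X Y
    using sr cube_point_in_sign_cube unfolding sign_represents_def by blast
  \<comment> \<open>Near \<open>2 ^ k\<close> the halfspace is false and the conjunction is 1 on all
    levels; near \<open>- (2 ^ k)\<close> it is true and the majority alone decides, with value
    \<open>s\<close>.\<close>
  have pos: "P (2 ^ k) (real l) > 0" "s * P (- (2 ^ k)) (real l) > 0"
    if k: "d + 2 \<le> k" "k \<le> n" and l: "l \<le> m" and s: "s = (if m < 2 * l then 1 else - 1)" for k l s
  proof -
    have k2: "(2::real) ^ k \<le> 2 ^ n" using k by (intro power_increasing) auto
    have "1 * level_mean p n m d (2 ^ k) l > 0"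
    proof (rule level_mean_pos[OF n _ l])
      fix X Y assume X: "\<And>i. X i \<subseteq> {1..n}" "Y \<subseteq> {1..m}" "card Y = l"
        "\<bar>(\<Sum>i=1..n. 2 ^ i * (2 * real (card (X i)) - real n)) - 2 ^ k\<bar> \<le> 2 * real (d + 1)"
      have "1 + (\<Sum>i=1..n. 2 ^ i * (2 * real (card (X i)) - real n)) \<ge> 0"
        using X(4) two_power_gt[OF k(1)] by linarith
      then show "1 * poly_eval p (cube_point n m X Y) > 0"
        using val[of X Y] by (simp only: fun_and_cube_point[OF X(1,2)] if_True simp_thms)
    qed (use k2 in simp)
    then show "P (2 ^ k) (real l) > 0" using P(3)[of "2 ^ k" l] l k2 by simp
    have "s * level_mean p n m d (- (2 ^ k)) l > 0"
    proof (rule level_mean_pos[OF n _ l])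
      fix X Y assume X: "\<And>i. X i \<subseteq> {1..n}" "Y \<subseteq> {1..m}" "card Y = l"
        "\<bar>(\<Sum>i=1..n. 2 ^ i * (2 * real (card (X i)) - real n)) - - (2 ^ k)\<bar> \<le> 2 * real (d + 1)"
      have "\<not> 1 + (\<Sum>i=1..n. 2 ^ i * (2 * real (card (X i)) - real n)) \<ge> 0"
        using X(4) two_power_gt[OF k(1)] by linarith
      then show "s * poly_eval p (cube_point n m X Y) > 0"
        using val[of X Y] unfolding fun_and_cube_point[OF X(1,2)] s X(3) by (simp only: simp_thms)
    qed (use k2 in simp)
    then show "s * P (- (2 ^ k)) (real l) > 0" using P(3)[of "- (2 ^ k)" l] l k2 by simp
  qed
  define lo hi where "lo = {..m div 2}" and "hi = {Suc (m div 2)..m}"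
  have fin: "finite lo" "finite hi" "lo \<noteq> {}" "hi \<noteq> {}" using dm by (auto simp: lo_def hi_def)
  have lo: "l \<le> m" "\<not> m < 2 * l" if "l \<in> lo" for l using that by (auto simp: lo_def)
  have hi: "l \<le> m" "m < 2 * l" if "l \<in> hi" for l using that by (auto simp: hi_def)
  define Ql Qh where "Ql = (\<lambda>t. \<Sum>l\<in>lo. P t (real l))" and "Qh = (\<lambda>t. \<Sum>l\<in>hi. P t (real l))"
  \<comment> \<open>At most \<open>m + 1\<close> levels, each extrapolated at a cost of
    \<open>2 ^ (m + d)\<close>. Since \<open>G\<close> is at most \<open>2 ^ (3 * m)\<close>, taking
    \<open>v = 6 * m + 4\<close> makes \<open>2 ^ v\<close> exceed \<open>9 * G\<^sup>2\<close>;
    \<open>w\<close> adds the margins.\<close>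
  define G :: real where "G = real (m + 1) * 2 ^ (m + d)"
  define w where "w = 6 * m + 4 + 2 * (d + 1)"
  have "w \<le> 7 * m + 6" using dm by (simp add: w_def)
  then have "(2 * d + 1) * w \<le> (2 * d + 1) * (7 * m + 6)" by (intro mult_left_mono) auto
  then have range: "k \<le> n" if "k \<le> d + 2 + (2 * d + 1) * w" for k using that big by linarith
  show False
  proof (rule no_bounded_sign_ratio[where v = "6 * m + 4" and G = G and ks = "d + 2"])
    show "poly_le d Ql" "poly_le d Qh" unfolding Ql_def Qh_def by (intro poly_le_sum P(1))+
    show "G > 0" by (simp add: G_def)
    have "real (m + 1) \<le> 2 ^ m"
      using of_nat_le_iff[of "m + 1" "2 ^ m", where 'a = real] Suc_leI[OF less_exp[of m]] by simp
    moreover have "(2::real) ^ (m + d) \<le> 2 ^ (2 * m)" using dm by (intro power_increasing) auto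
    ultimately have "G \<le> 2 ^ m * 2 ^ (2 * m)" unfolding G_def by (intro mult_mono) auto
    then have "G\<^sup>2 \<le> (2 ^ m * 2 ^ (2 * m))\<^sup>2" using \<open>G > 0\<close> by (intro power_mono) auto
    also have "\<dots> = (2::real) ^ (6 * m)" by (simp add: power_mult[symmetric] power_add[symmetric] power_mult_distrib)
    finally have "9 * G\<^sup>2 \<le> 9 * 2 ^ (6 * m)" by simp
    also have "\<dots> < 2 ^ (6 * m + 4)" by (simp add: power_add)
    finally show "9 * G\<^sup>2 < 2 ^ (6 * m + 4)" .
    show "w = 6 * m + 4 + 2 * (d + 1)" by (rule w_def)
  next
    fix k assume k: "d + 2 \<le> k" "k \<le> d + 2 + (2 * d + 1) * w"
    note pos = pos[OF k(1) range[OF k(2)]]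
    have "(\<Sum>l\<in>lo. - P (- (2 ^ k)) (real l)) > 0"
      using fin pos(2)[of _ "- 1"] lo by (intro sum_pos) auto
    then have "Ql (- (2 ^ k)) < 0" by (simp add: Ql_def sum_negf)
    then show "Ql (2 ^ k) > 0 \<and> Ql (- (2 ^ k)) < 0 \<and> Qh (2 ^ k) > 0 \<and> Qh (- (2 ^ k)) > 0"
      unfolding Ql_def Qh_def using fin pos(1) pos(2)[of _ 1] lo hi by (auto intro!: sum_pos)
    define t :: real where "t = 2 ^ k"
    \<comment> \<open>At positive \<open>t\<close> all levels have positive means, so each is
      bounded by the sum over its half.\<close>
    have le_Ql: "\<bar>P t (real l)\<bar> \<le> Ql t" if "l \<in> lo" for l
    proof -
      have "P t (real l) \<le> Ql t" unfolding Ql_def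
        using pos(1) lo fin by (intro member_le_sum that) (auto simp: t_def intro: less_imp_le)
      then show ?thesis using pos(1)[OF lo(1)[OF that]] by (simp add: t_def)
    qed
    have le_Qh: "\<bar>P t (real l)\<bar> \<le> Qh t" if "l \<in> hi" for l
    proof -
      have "P t (real l) \<le> Qh t" unfolding Qh_def
        using pos(1) hi fin by (intro member_le_sum that) (auto simp: t_def intro: less_imp_le)
      then show ?thesis using pos(1)[OF hi(1)[OF that]] by (simp add: t_def)
    qed
    have Q0: "Ql t \<ge> 0" "Qh t \<ge> 0"
      using le_Ql le_Qh fin(3,4) abs_ge_zero order_trans by (metis ex_in_conv)+
    have bound: "sum f L \<le> G * B" if "\<And>l. l \<in> L \<Longrightarrow> f l \<le> 2 ^ (m + d) * B" "card L \<le> m + 1" "B \<ge> 0"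
      for f :: "nat \<Rightarrow> real" and L B
    proof -
      have "sum f L \<le> real (card L) * (2 ^ (m + d) * B)" using sum_bounded_above that(1) by metis
      also have "\<dots> \<le> real (m + 1) * (2 ^ (m + d) * B)"
        using that by (intro mult_right_mono) (auto simp del: of_nat_Suc)
      finally show ?thesis by (simp add: G_def mult_ac)
    qed
    have "Ql t \<le> G * Qh t" unfolding Ql_def
    proof (rule bound)
      fix l assume l: "l \<in> lo"
      \<comment> \<open>Reflection at \<open>m\<close>: the nodes 0, ..., \<open>d\<close> become
        the top levels, which all lie in \<open>hi\<close>.\<close>
      have "poly_le d (\<lambda>x. P t (real m - x))"
        using poly_le_compose_linear[OF P(2), of t "real m" "- 1"] by simp
      moreover have "\<bar>P t (real m - real i)\<bar> \<le> Qh t" if "i \<le> d" for i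
      proof -
        have "m - i \<in> hi" using that dm by (auto simp: hi_def)
        moreover have "real m - real i = real (m - i)" using that dm by simp
        ultimately show ?thesis using le_Qh by metis
      qed
      ultimately have "\<bar>P t (real m - real (m - l))\<bar> \<le> 2 ^ (m - l + d) * Qh t"
        by (rule poly_extrapolation)
      also have "\<dots> \<le> 2 ^ (m + d) * Qh t" using Q0 by (intro mult_right_mono power_increasing) auto
      finally show "P t (real l) \<le> 2 ^ (m + d) * Qh t" using lo[OF l] by (simp add: of_nat_diff)
    qed (use Q0 in \<open>auto simp: lo_def\<close>)
    moreover have "Qh t \<le> G * Ql t" unfolding Qh_def
    proof (rule bound)
      fix l assume l: "l \<in> hi"
      \<comment> \<open>Here the nodes 0, ..., \<open>d\<close> themselves lie in
        \<open>lo\<close>.\<close>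
      have "\<bar>P t (real l)\<bar> \<le> 2 ^ (l + d) * Ql t"
        using dm by (intro poly_extrapolation P(2) le_Ql) (auto simp: lo_def)
      also have "\<dots> \<le> 2 ^ (m + d) * Ql t" using Q0 hi[OF l] by (intro mult_right_mono power_increasing) auto
      finally show "P t (real l) \<le> 2 ^ (m + d) * Ql t" by simp
    qed (use Q0 in \<open>auto simp: hi_def\<close>)
    ultimately show "Ql (2 ^ k) \<le> G * Qh (2 ^ k) \<and> Qh (2 ^ k) \<le> G * Ql (2 ^ k)" by (simp add: t_def)
  qed
qed

section \<open>The upper bound\<close>

lemma poly_eval_add: "poly_eval (p + q) z = poly_eval p z + poly_eval q z"
proof -
  let ?K = "Poly_Mapping.keys p \<union> Poly_Mapping.keys q"
  have sup: "poly_eval r z = (\<Sum>m\<in>?K. Poly_Mapping.lookup r m * monomial_eval m z)"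
    if "Poly_Mapping.keys r \<subseteq> ?K" for r
    unfolding poly_eval_def using that by (intro sum.mono_neutral_left) (auto simp: in_keys_iff)
  show ?thesis
    using sup[of p] sup[of q] sup[OF Poly_Mapping.keys_add]
    by (simp add: lookup_add distrib_right sum.distrib)
qed

lemma poly_eval_single: "poly_eval (Poly_Mapping.single m c) z = c * monomial_eval m z"
  by (cases "c = 0") (simp_all add: poly_eval_def)

lemma monomial_eval_mult_var:
  "monomial_eval (m + Poly_Mapping.single v 1) z = z v * monomial_eval m z"
proof -
  let ?K = "insert v (Poly_Mapping.keys m)"
  have sup: "monomial_eval r z = (\<Prod>w\<in>?K. z w ^ Poly_Mapping.lookup r w)"
    if "Poly_Mapping.keys r \<subseteq> ?K" for r
    unfolding monomial_eval_def using that by (intro prod.mono_neutral_left) (auto simp: in_keys_iff)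
  have keys: "Poly_Mapping.keys (m + Poly_Mapping.single v 1) \<subseteq> ?K"
    using Poly_Mapping.keys_add[of m "Poly_Mapping.single v 1"] by auto
  have "monomial_eval (m + Poly_Mapping.single v 1) z =
      (\<Prod>w\<in>?K. z w ^ Poly_Mapping.lookup m w * (if w = v then z v else 1))"
    unfolding sup[OF keys] by (intro prod.cong) (auto simp: lookup_add lookup_single)
  also have "\<dots> = monomial_eval m z * z v"
    by (subst sup[of m]) (auto simp: prod.distrib prod.delta)
  finally show ?thesis by simp
qed

lemma monomial_degree_mult_var: "monomial_degree (m + Poly_Mapping.single v 1) = Suc (monomial_degree m)"
proof -
  let ?K = "insert v (Poly_Mapping.keys m)"
  have sup: "monomial_degree r = (\<Sum>w\<in>?K. Poly_Mapping.lookup r w)"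
    if "Poly_Mapping.keys r \<subseteq> ?K" for r
    unfolding monomial_degree_def using that by (intro sum.mono_neutral_left) (auto simp: in_keys_iff)
  have keys: "Poly_Mapping.keys (m + Poly_Mapping.single v 1) \<subseteq> ?K"
    using Poly_Mapping.keys_add[of m "Poly_Mapping.single v 1"] by auto
  have "monomial_degree (m + Poly_Mapping.single v 1) =
      (\<Sum>w\<in>?K. Poly_Mapping.lookup m w + (if w = v then 1 else 0))"
    unfolding sup[OF keys] by (intro sum.cong) (auto simp: lookup_add lookup_single)
  also have "\<dots> = monomial_degree m + 1"
    by (subst sup[of m]) (auto simp: sum.distrib sum.delta)
  finally show ?thesis by simp
qed

text \<open>Allows polynomials to be assembled as functions on all points, with variables and degree
  tracked alongside.\<close>

definition polynomial_fun :: "'v set \<Rightarrow> nat \<Rightarrow> (('v \<Rightarrow> real) \<Rightarrow> real) \<Rightarrow> bool" where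
  "polynomial_fun V d f \<longleftrightarrow> (\<exists>p. poly_vars p \<subseteq> V \<and> total_degree p \<le> d \<and> poly_eval p = f)"

lemma polynomial_fun_add:
  assumes "polynomial_fun V d f" "polynomial_fun V d g"
  shows "polynomial_fun V d (\<lambda>z. f z + g z)"
proof -
  obtain p q where pq: "poly_vars p \<subseteq> V" "total_degree p \<le> d" "poly_eval p = f"
    "poly_vars q \<subseteq> V" "total_degree q \<le> d" "poly_eval q = g"
    using assms unfolding polynomial_fun_def by blast
  have sub: "Poly_Mapping.keys (p + q) \<subseteq> Poly_Mapping.keys p \<union> Poly_Mapping.keys q"
    by (rule Poly_Mapping.keys_add)
  have "poly_vars (p + q) \<subseteq> poly_vars p \<union> poly_vars q"
    unfolding poly_vars_def UN_Un[symmetric] by (rule UN_mono[OF sub]) simp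
  then have "poly_vars (p + q) \<subseteq> V" using pq(1,4) by blast
  moreover have "total_degree (p + q) \<le> d" using sub pq(2,5) unfolding total_degree_le_iff by blast
  moreover have "poly_eval (p + q) = (\<lambda>z. f z + g z)" using pq by (auto simp: poly_eval_add)
  ultimately show ?thesis unfolding polynomial_fun_def by blast
qed

lemma polynomial_fun_monomial:
  assumes "Poly_Mapping.keys m \<subseteq> V" "monomial_degree m \<le> d"
  shows "polynomial_fun V d (\<lambda>z. c * monomial_eval m z)"
proof -
  have "poly_vars (Poly_Mapping.single m c) \<subseteq> V" using assms by (simp add: poly_vars_def)
  moreover have "total_degree (Poly_Mapping.single m c) \<le> d" using assms by (simp add: total_degree_le_iff)
  moreover have "poly_eval (Poly_Mapping.single m c) = (\<lambda>z. c * monomial_eval m z)"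
    by (auto simp: poly_eval_single)
  ultimately show ?thesis unfolding polynomial_fun_def by blast
qed

lemma polynomial_fun_const: "polynomial_fun V d (\<lambda>_. c)"
  using polynomial_fun_monomial[of 0 V d c] by (simp add: monomial_eval_def monomial_degree_def)

lemma polynomial_fun_sum:
  "(\<And>i. i \<in> I \<Longrightarrow> polynomial_fun V d (f i)) \<Longrightarrow> polynomial_fun V d (\<lambda>z. \<Sum>i\<in>I. f i z)"
  by (induction I rule: infinite_finite_induct) (auto intro: polynomial_fun_const polynomial_fun_add)

lemma polynomial_fun_cmult:
  assumes "polynomial_fun V d f" shows "polynomial_fun V d (\<lambda>z. c * f z)"
proof -
  obtain p where p: "poly_vars p \<subseteq> V" "total_degree p \<le> d" "poly_eval p = f"
    using assms unfolding polynomial_fun_def by blast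
  have "polynomial_fun V d (\<lambda>z. \<Sum>m\<in>Poly_Mapping.keys p. (c * Poly_Mapping.lookup p m) * monomial_eval m z)"
    using p(1,2) by (intro polynomial_fun_sum polynomial_fun_monomial) (auto simp: poly_vars_def total_degree_le_iff)
  also have "(\<lambda>z. \<Sum>m\<in>Poly_Mapping.keys p. (c * Poly_Mapping.lookup p m) * monomial_eval m z) = (\<lambda>z. c * f z)"
    unfolding p(3)[symmetric] poly_eval_def by (simp add: sum_distrib_left mult_ac)
  finally show ?thesis .
qed

lemma polynomial_fun_mult_var:
  assumes "polynomial_fun V d f" "v \<in> V" shows "polynomial_fun V (Suc d) (\<lambda>z. z v * f z)"
proof -
  obtain p where p: "poly_vars p \<subseteq> V" "total_degree p \<le> d" "poly_eval p = f"
    using assms unfolding polynomial_fun_def by blast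
  have "polynomial_fun V (Suc d) (\<lambda>z. \<Sum>m\<in>Poly_Mapping.keys p.
      Poly_Mapping.lookup p m * monomial_eval (m + Poly_Mapping.single v 1) z)"
  proof (intro polynomial_fun_sum polynomial_fun_monomial)
    fix m assume m: "m \<in> Poly_Mapping.keys p"
    show "Poly_Mapping.keys (m + Poly_Mapping.single v 1) \<subseteq> V"
      using Poly_Mapping.keys_add[of m "Poly_Mapping.single v 1"] p(1) m assms(2)
      by (auto simp: poly_vars_def)
    show "monomial_degree (m + Poly_Mapping.single v 1) \<le> Suc d"
      unfolding monomial_degree_mult_var using m p(2) by (simp add: total_degree_le_iff)
  qed
  also have "(\<lambda>z. \<Sum>m\<in>Poly_Mapping.keys p.
      Poly_Mapping.lookup p m * monomial_eval (m + Poly_Mapping.single v 1) z) = (\<lambda>z. z v * f z)"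
    unfolding p(3)[symmetric] poly_eval_def monomial_eval_mult_var by (simp add: sum_distrib_left mult_ac)
  finally show ?thesis .
qed

lemma polynomial_fun_mono: "polynomial_fun V d f \<Longrightarrow> d \<le> e \<Longrightarrow> polynomial_fun V e f"
  unfolding polynomial_fun_def by (blast intro: order_trans)

lemma polynomial_fun_linear_product:
  assumes "\<And>j. j \<in> J \<Longrightarrow> x j \<in> V"
  shows "polynomial_fun V k (\<lambda>z. \<Prod>l<k. (\<Sum>j\<in>J. z (x j)) - a l)"
proof (induction k)
  case (Suc k)
  define f where "f = (\<lambda>z. \<Prod>l<k. (\<Sum>j\<in>J. z (x j)) - a l)"
  have "polynomial_fun V (Suc k) (\<lambda>z. (\<Sum>j\<in>J. z (x j) * f z) + (- a k) * f z)"
    using Suc assms by (intro polynomial_fun_add polynomial_fun_sum polynomial_fun_mult_var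
        polynomial_fun_mono[OF polynomial_fun_cmult[of V k]]) (auto simp: f_def)
  also have "(\<lambda>z. (\<Sum>j\<in>J. z (x j) * f z) + (- a k) * f z) = (\<lambda>z. \<Prod>l<Suc k. (\<Sum>j\<in>J. z (x j)) - a l)"
    by (auto simp: f_def sum_distrib_right algebra_simps)
  finally show ?case .
qed (simp add: polynomial_fun_const)

section \<open>A sign-representing polynomial of small degree\<close>

lemma ex_sign_represents:
  obtains p where
    "sign_represents (({1..n} \<times> {1..n}) <+> {1..m}) p (fun_and (weighted_halfspace n) (majority m))"
    "total_degree p \<le> m div 2 + 1"
proof -
  let ?V = "({1..n} \<times> {1..n}) <+> {1..m}"
  define L where "L = (\<lambda>z. 1 + (\<Sum>i=1..n. \<Sum>j=1..n. 2 ^ i * z (Inl (i, j) :: (nat \<times> nat) + nat)) :: real)"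
  define H where "H = (\<lambda>z. \<Prod>l<m div 2 + 1. (\<Sum>j\<in>{1..m}. z (Inr j :: (nat \<times> nat) + nat)) - (2 * real l - real m))"
  \<comment> \<open>Larger than every value of the halfspace form on the cube in absolute
    terms.\<close>
  define C where "C = 2 + (\<Sum>i=1..n. 2 ^ i * real n)"
  have "polynomial_fun ?V (m div 2 + 1) (\<lambda>z. L z + C * H z)"
    unfolding L_def
  proof (intro polynomial_fun_add polynomial_fun_const polynomial_fun_sum polynomial_fun_cmult)
    show "polynomial_fun ?V (m div 2 + 1) H"
      unfolding H_def by (rule polynomial_fun_linear_product) auto
    fix i j assume "i \<in> {1..n}" "j \<in> {1..n}"
    then have "polynomial_fun ?V (Suc 0) (\<lambda>z. z (Inl (i, j)) * 1)"
      by (intro polynomial_fun_mult_var polynomial_fun_const) auto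
    then show "polynomial_fun ?V (m div 2 + 1) (\<lambda>z. z (Inl (i, j)))"
      using polynomial_fun_mono by fastforce
  qed
  then obtain p where p: "poly_vars p \<subseteq> ?V" "total_degree p \<le> m div 2 + 1" "poly_eval p = (\<lambda>z. L z + C * H z)"
    unfolding polynomial_fun_def by blast
  have "fun_and (weighted_halfspace n) (majority m) z * (L z + C * H z) > 0" if z: "z \<in> sign_cube ?V" for z
  proof -
    obtain X Y where X: "\<And>i. X i \<subseteq> {1..n}" "Y \<subseteq> {1..m}" "z = cube_point n m X Y"
      using sign_cube_cases[OF z] by blast
    define a where "a = (\<Sum>i=1..n. 2 ^ i * (2 * real (card (X i)) - real n))"
    have L: "L z = 1 + a" using halfspace_form_cube_point[where X = X and m = m and Y = Y, OF X(1)]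
      by (simp add: L_def X(3) a_def)
    have H: "H z = (\<Prod>l<m div 2 + 1. 2 * (real (card Y) - real l))"
      unfolding H_def X(3) majority_form_cube_point[OF X(2)] by (simp add: algebra_simps)
    have val: "fun_and (weighted_halfspace n) (majority m) z = (if m < 2 * card Y \<or> 1 + a \<ge> 0 then 1 else - 1)"
      unfolding X(3) a_def by (rule fun_and_cube_point[OF X(1,2)])
    show ?thesis
    proof (cases "m < 2 * card Y")
      case True
      \<comment> \<open>Every \<open>l\<close> in the product is below \<open>card Y\<close>, so
        each factor is at least 2.\<close>
      have "1 \<le> H z" unfolding H using True by (intro prod_ge_1) auto
      moreover have "C \<ge> 0" unfolding C_def by (intro add_nonneg_nonneg sum_nonneg) auto
      ultimately have "C * 1 \<le> C * H z" by (intro mult_left_mono)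
      moreover have "\<bar>a\<bar> \<le> (\<Sum>i=1..n. 2 ^ i * real n)"
        unfolding a_def
      proof (rule order_trans[OF sum_abs sum_mono])
        fix i
        have "card (X i) \<le> n" using card_mono[OF _ X(1)[of i]] by simp
        then show "\<bar>2 ^ i * (2 * real (card (X i)) - real n)\<bar> \<le> 2 ^ i * real n"
          by (simp add: abs_mult abs_le_iff)
      qed
      ultimately show ?thesis using val True L by (simp add: C_def)
    next
      case False
      \<comment> \<open>The factor with \<open>l = card Y\<close> vanishes.\<close>
      then have "H z = 0" unfolding H by (intro prod_zero) auto
      \<comment> \<open>With \<open>H z = 0\<close> the form must decide strictly. Block indices
        start at 1, so all weights are even and \<open>1 + a\<close> is odd.\<close>
      moreover have "1 + a \<noteq> 0"
      proof -
        define b :: int where "b = (\<Sum>i=1..n. 2 ^ (i - 1) * (2 * int (card (X i)) - int n))"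
        have "a = real_of_int (\<Sum>i=1..n. 2 ^ i * (2 * int (card (X i)) - int n))" by (simp add: a_def)
        also have "(\<Sum>i=1..n. 2 ^ i * (2 * int (card (X i)) - int n)) = 2 * b"
          unfolding b_def sum_distrib_left
        proof (intro sum.cong refl)
          fix i assume "i \<in> {1..n}"
          then show "2 ^ i * (2 * int (card (X i)) - int n) = 2 * (2 ^ (i - 1) * (2 * int (card (X i)) - int n))"
            by (cases i) auto
        qed
        finally have "1 + a = real_of_int (1 + 2 * b)" by simp
        moreover have "1 + 2 * b \<noteq> 0" by presburger
        ultimately show ?thesis by (metis of_int_eq_0_iff)
      qed
      ultimately show ?thesis using val L False by auto
    qed
  qed
  then have "sign_represents ?V p (fun_and (weighted_halfspace n) (majority m))"
    using p unfolding sign_represents_def by simp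
  then show thesis using that p(2) by blast
qed

section \<open>Bounds on the threshold degree and its growth\<close>

lemma threshold_degree_upper:
  "threshold_degree (({1..n} \<times> {1..n}) <+> {1..m}) (fun_and (weighted_halfspace n) (majority m)) \<le> m div 2 + 1"
proof -
  obtain p where
    "sign_represents (({1..n} \<times> {1..n}) <+> {1..m}) p (fun_and (weighted_halfspace n) (majority m))"
    "total_degree p \<le> m div 2 + 1"
    by (rule ex_sign_represents)
  then show ?thesis unfolding threshold_degree_def by (metis (mono_tags, lifting) Least_le order_trans)
qed

lemma threshold_degree_lower:
  assumes "2 * d < m" "3 * (d + 1) \<le> n" "(d + 2) + (2 * d + 1) * (7 * m + 6) \<le> n"
  shows "d < threshold_degree (({1..n} \<times> {1..n}) <+> {1..m}) (fun_and (weighted_halfspace n) (majority m))"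
proof -
  let ?R = "\<lambda>p. sign_represents (({1..n} \<times> {1..n}) <+> {1..m}) p (fun_and (weighted_halfspace n) (majority m))"
  \<comment> \<open>Some representing polynomial must exist for the \<open>LEAST\<close> to be
    attained.\<close>
  obtain q where "?R q" by (rule ex_sign_represents)
  then have "\<exists>e p. ?R p \<and> total_degree p = e" by blast
  from LeastI_ex[OF this] obtain p where
    "?R p" "total_degree p = threshold_degree (({1..n} \<times> {1..n}) <+> {1..m}) (fun_and (weighted_halfspace n) (majority m))"
    unfolding threshold_degree_def by blast
  then show ?thesis using total_degree_gt[OF _ assms] by metis
qed

theorem theorem1p9:
  shows "(\<lambda>n::nat. real (threshold_degree
            (({1..n} \<times> {1..n}) <+> {1..nat \<lceil>sqrt (real n)\<rceil>})
            (fun_and (weighted_halfspace n) (majority (nat \<lceil>sqrt (real n)\<rceil>)))))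
         \<in> \<Theta>(\<lambda>n. sqrt (real n))"
proof (rule bigthetaI)
  let ?T = "\<lambda>n. threshold_degree (({1..n} \<times> {1..n}) <+> {1..nat \<lceil>sqrt (real n)\<rceil>})
            (fun_and (weighted_halfspace n) (majority (nat \<lceil>sqrt (real n)\<rceil>)))"
  show "(\<lambda>n. real (?T n)) \<in> O(\<lambda>n. sqrt (real n))"
  \<comment> \<open>For \<open>n \<ge> 1\<close> the degree is at most \<open>m + 1\<close>, hence
    at most \<open>sqrt n + 2\<close>, which is at most \<open>3 * sqrt n\<close>.\<close>
  proof (rule landau_o.bigI[where c = 3])
    show "\<forall>\<^sub>F n in sequentially. norm (real (?T n)) \<le> 3 * norm (sqrt (real n))"
      using eventually_ge_at_top[of 1]
    proof eventually_elim
      case (elim n)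
      define m where "m = nat \<lceil>sqrt (real n)\<rceil>"
      have r: "sqrt (real n) \<ge> 1" using elim by simp
      then have "real m \<le> sqrt (real n) + 1" by (simp add: m_def)
      moreover have "real (?T n) \<le> real m + 1"
        using threshold_degree_upper[of n m] unfolding m_def[symmetric] by linarith
      ultimately show ?case using r unfolding real_norm_def by linarith
    qed
  qed simp
  show "(\<lambda>n. real (?T n)) \<in> \<Omega>(\<lambda>n. sqrt (real n))"
  proof (rule landau_omega.bigI[where c = "1 / 100"])
    show "\<forall>\<^sub>F n in sequentially. norm (real (?T n)) \<ge> 1 / 100 * norm (sqrt (real n))"
      \<comment> \<open>From here on \<open>r \<ge> 20\<close>, so terms linear in \<open>r\<close>
        are absorbed by \<open>r * r\<close>.\<close>
      using eventually_ge_at_top[of 400]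
    proof eventually_elim
      case (elim n)
      define r where "r = sqrt (real n)"
      define m where "m = nat \<lceil>r\<rceil>"
      \<comment> \<open>The product \<open>(2 * d + 1) * (7 * m + 6)\<close> then has leading term
        \<open>7 / 50 * (r * r)\<close>, well below \<open>n\<close>, while \<open>d + 1\<close> is
        still at least \<open>r / 100\<close>.\<close>
      define d where "d = nat \<lfloor>r / 100\<rfloor>"
      have "sqrt 400 \<le> r" unfolding r_def using elim by (intro real_sqrt_le_mono) simp
      then have r: "r \<ge> 20" using real_sqrt_abs[of 20] by simp
      have n: "real n = r * r" by (simp add: r_def)
      have rr: "20 * r \<le> r * r" using r by (intro mult_right_mono) auto
      have m: "r \<le> real m" "real m \<le> r + 1" using r by (auto simp: m_def) linarith?
      have d: "real d \<le> r / 100" "r / 100 \<le> real d + 1" using r by (auto simp: d_def) linarith+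
      have "d < ?T n" unfolding r_def[symmetric] m_def[symmetric]
      proof (rule threshold_degree_lower)
        have "real (2 * d) < real m" using d m r by simp
        then show "2 * d < m" by (simp only: of_nat_less_iff)
        have "real (3 * (d + 1)) = 3 * real d + 3" by simp
        also have "\<dots> \<le> real n" unfolding n using d r rr by linarith
        finally have "real (3 * (d + 1)) \<le> real n" .
        then show "3 * (d + 1) \<le> n" by (simp only: of_nat_le_iff)
        have "(2 * real d + 1) * (7 * real m + 6) \<le> (r / 50 + 1) * (7 * r + 13)"
          using d m r by (intro mult_mono) auto
        moreover have "real ((d + 2) + (2 * d + 1) * (7 * m + 6)) =
            real d + 2 + (2 * real d + 1) * (7 * real m + 6)" by (simp add: algebra_simps)
        ultimately have "real ((d + 2) + (2 * d + 1) * (7 * m + 6)) \<le> r / 100 + 2 + (r / 50 + 1) * (7 * r + 13)"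
          using d by linarith
        also have "(r / 50 + 1) * (7 * r + 13) = 7 / 50 * (r * r) + 363 / 50 * r + 13"
          by (simp add: field_simps)
        also have "r / 100 + 2 + (7 / 50 * (r * r) + 363 / 50 * r + 13) \<le> r * r" using r rr by linarith
        finally show "(d + 2) + (2 * d + 1) * (7 * m + 6) \<le> n" unfolding n[symmetric] by (simp only: of_nat_le_iff)
      qed
      then have "real d + 1 \<le> real (?T n)" by linarith
      then show ?case using d r r_def unfolding real_norm_def by linarith
    qed
  qed simp
qed

end
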